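(* For each $N\ge 2$ let $(X_n)_{0\le n\le N}$ be the edge-counting process of the growing random graph with $N$ vertices; let $\Delta X_n:=X_n-X_{n-1}$ for $1\le n\le N$ and $\Delta X_{N+1}:=\binom N2-X_N$. For each fixed integer $m\ge 0$, the random vector $$\left(\frac{\Delta X_{N-m+1}}{N\log N},\,\frac{\Delta X_{N-m+2}}{N\log N},\,\ldots,\,\frac{\Delta X_{N+1}}{N\log N}\right)$$ (with $m+1$ components) converges in distribution, as $N\to\infty$, to a vector of $m+1$ i.i.d. exponential random variables with mean one.
   Context: Growing random graph. Fix $N$. Initially there is a pool of $N$ virtual vertices and no edges. At each step, an element is selected uniformly at random from the current pool of virtual elements (vertices and edges), removed from the pool, and declared occupied. When the $n$-th vertex becomes occupied (it is then labelled $n$), the $n-1$ edges linking it to the previously occupied vertices $1,\dots,n-1$ are added to the pool as virtual edges. Thus when there are $n$ occupied vertices and $k$ occupied edges, the pool consists of $N-n$ virtual vertices and $\binom n2-k$ virtual edges. The process continues until the pool is empty (complete graph on $N$ vertices). For $1\le n\le N$, $X_n$ is the number of occupied edges at the moment the $n$-th vertex becomes occupied; $X_0=0$. The law of $(X_n)$ depends on $N$. Equivalently, $(X_n)$ is a Markov chain with $X_0=X_1=0$ such that, for $1\le n<N$, given $X_n=k$, the increment $X_{n+1}-X_n$ is the number of black balls drawn before the first white ball when sampling uniformly without replacement from an urn with $\binom n2-k$ black and $N-n$ white balls. *)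

theory Defs
  imports "HOL-Probability.Probability"
begin

text \<open>Elements of the pool. Vertices carry a fixed name in \<open>{1..N}\<close>; the element \<open>Edge i j\<close>
  with \<open>i < j\<close> is the edge between the vertices that became occupied as \<open>i\<close>-th and \<open>j\<close>-th.\<close>

datatype element = is_vertex: Vertex nat | is_edge: Edge nat nat

text \<open>A history lists the occupied elements in the order in which they became occupied.\<close>

definition num_vertices :: "element list \<Rightarrow> nat" where
  "num_vertices h = length (filter is_vertex h)"

definition num_edges :: "element list \<Rightarrow> nat" where
  "num_edges h = length (filter is_edge h)"

definition pool :: "nat \<Rightarrow> element list \<Rightarrow> element set" where
  "pool N h =
     (Vertex ` {1..N} \<union> {Edge i j |i j. 1 \<le> i \<and> i < j \<and> j \<le> num_vertices h}) - set h"

fun history :: "nat \<Rightarrow> nat \<Rightarrow> element list pmf" where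
  "history N 0 = return_pmf []"
| "history N (Suc t) =
     bind_pmf (history N t) (\<lambda>h.
       if pool N h = {} then return_pmf h
       else map_pmf (\<lambda>x. h @ [x]) (pmf_of_set (pool N h)))"

text \<open>There are \<open>N + (N choose 2)\<close> elements in total, so after that many steps the pool is empty
  (see \<open>pool_growing_graph\<close> below).\<close>

definition growing_graph :: "nat \<Rightarrow> element list pmf" where
  "growing_graph N = history N (N + (N choose 2))"

text \<open>The number of occupied edges at the moment the \<open>n\<close>-th vertex becomes occupied;
  for \<open>n = 0\<close> this is \<open>0\<close>.\<close>

definition X :: "nat \<Rightarrow> element list \<Rightarrow> nat" where
  "X n h = num_edges (take (LEAST t. n \<le> num_vertices (take t h)) h)"

definition \<Delta>X :: "nat \<Rightarrow> nat \<Rightarrow> element list \<Rightarrow> real" where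
  "\<Delta>X N n h =
     (if n \<le> N then real (X n h) - real (X (n - 1) h)
      else real (N choose 2) - real (X N h))"

text \<open>Convergence in distribution of Borel laws on the space \<open>T\<close>. The measures are expected to
  make all continuous real functions on \<open>T\<close> measurable; for the product space used for
  finite-dimensional random vectors, see \<open>borel_measurable_PiM_continuous_map\<close> below.\<close>

definition converges_in_distribution ::
  "'a topology \<Rightarrow> (nat \<Rightarrow> 'a measure) \<Rightarrow> 'a measure \<Rightarrow> bool" where
  "converges_in_distribution T \<mu> \<nu> \<longleftrightarrow>
     (\<forall>f :: 'a \<Rightarrow> real. continuous_map T euclideanreal f \<and> bounded (f ` topspace T) \<longrightarrow>
        (\<lambda>N. \<integral>x. f x \<partial>\<mu> N) \<longlonglongrightarrow> (\<integral>x. f x \<partial>\<nu>))"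

lemma finite_edges: "finite {Edge i j |i j. 1 \<le> i \<and> i < j \<and> j \<le> n}"
  by (rule finite_subset[of _ "(\<lambda>(i, j). Edge i j) ` ({..n} \<times> {..n})"]) auto

lemma finite_pool: "finite (pool N h)"
  unfolding pool_def using finite_edges[of "num_vertices h"] by blast

lemma card_edges: "card {Edge i j |i j. 1 \<le> i \<and> i < j \<and> j \<le> n} = n choose 2"
proof (induction n)
  case (Suc n)
  have "{Edge i j |i j. 1 \<le> i \<and> i < j \<and> j \<le> Suc n} =
      {Edge i j |i j. 1 \<le> i \<and> i < j \<and> j \<le> n} \<union> (\<lambda>i. Edge i (Suc n)) ` {1..n}"
    by (auto simp: le_Suc_eq)
  also have "card \<dots> = (n choose 2) + n"
    using Suc finite_edges[of n] by (subst card_Un_disjoint) (auto simp: card_image inj_on_def)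
  finally show ?case by (simp add: numeral_2_eq_2)
qed (auto simp: binomial_eq_0)

lemma history_invariant:
  assumes "h \<in> set_pmf (history N t)"
  shows "distinct h \<and> set h \<subseteq> Vertex ` {1..N} \<union> {Edge i j |i j. 1 \<le> i \<and> i < j \<and> j \<le> N}
    \<and> num_vertices h \<le> N \<and> (pool N h = {} \<or> length h = t)"
  using assms
proof (induction t arbitrary: h)
  case (Suc t)
  then obtain g where g: "g \<in> set_pmf (history N t)"
    and h: "h \<in> set_pmf (if pool N g = {} then return_pmf g
       else map_pmf (\<lambda>x. g @ [x]) (pmf_of_set (pool N g)))"
    by auto
  note IH = Suc.IH[OF g]
  show ?case
  proof (cases "pool N g = {}")
    case True
    then show ?thesis using h IH by simp
  next
    case False
    then obtain x where x: "x \<in> pool N g" "h = g @ [x]"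
      using h finite_pool by auto
    have 1: "distinct h" and 2: "length h = Suc t"
      using x IH False by (auto simp: pool_def)
    have 3: "set h \<subseteq> Vertex ` {1..N} \<union> {Edge i j |i j. 1 \<le> i \<and> i < j \<and> j \<le> N}"
    proof -
      have "pool N g \<subseteq> Vertex ` {1..N} \<union> {Edge i j |i j. 1 \<le> i \<and> i < j \<and> j \<le> N}"
        unfolding pool_def using IH by auto
      then show ?thesis using x IH by auto
    qed
    have "num_vertices h = card (set (filter is_vertex h))"
      unfolding num_vertices_def using 1 by (metis distinct_card distinct_filter)
    also have "\<dots> \<le> card (Vertex ` {1..N})"
      using 3 by (intro card_mono) auto
    also have "\<dots> = N" by (simp add: card_image inj_on_def)
    finally show ?thesis using 1 2 3 by blast
  qed
qed (simp add: num_vertices_def)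

lemma pool_growing_graph:
  assumes "h \<in> set_pmf (growing_graph N)"
  shows "pool N h = {}"
proof (rule ccontr)
  assume ne: "pool N h \<noteq> {}"
  let ?V = "Vertex ` {1..N}" and ?E = "{Edge i j |i j. 1 \<le> i \<and> i < j \<and> j \<le> N}"
  note inv = history_invariant[OF assms[unfolded growing_graph_def]]
  have "card (?V \<union> ?E) = N + (N choose 2)"
    using finite_edges[of N] card_edges[of N]
    by (subst card_Un_disjoint) (auto simp: card_image inj_on_def)
  moreover have "card (set h) = N + (N choose 2)"
    using inv ne by (simp add: distinct_card)
  ultimately have "set h = ?V \<union> ?E"
    using inv finite_edges[of N] by (intro card_subset_eq) auto
  moreover have "pool N h \<subseteq> (?V \<union> ?E) - set h"
    using inv by (auto simp: pool_def)
  ultimately show False using ne by auto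
qed

lemma borel_measurable_PiM_continuous_map:
  fixes f :: "(nat \<Rightarrow> real) \<Rightarrow> real"
  assumes f: "continuous_map (product_topology (\<lambda>_. euclideanreal) I) euclideanreal f"
  shows "f \<in> borel_measurable (PiM I (\<lambda>_. borel))"
proof -
  have "continuous_map (product_topology (\<lambda>_. euclideanreal) UNIV)
      (product_topology (\<lambda>_. euclideanreal) I) (\<lambda>x. restrict x I)"
    by (subst continuous_map_componentwise) (auto intro: continuous_map_product_projection)
  from continuous_map_compose[OF this f]
  have "continuous_on UNIV (\<lambda>x. f (restrict x I))"
    by (simp add: o_def euclidean_product_topology)
  then have m: "(\<lambda>x. f (restrict x I)) \<in> borel_measurable (PiM UNIV (\<lambda>_. borel))"
    by (subst measurable_cong_sets[OF sets_PiM_equal_borel refl])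
      (rule borel_measurable_continuous_onI)
  have e: "(\<lambda>x i. if i \<in> I then x i else 0) \<in> PiM I (\<lambda>_. borel) \<rightarrow>\<^sub>M PiM UNIV (\<lambda>_. borel :: real measure)"
  proof (rule measurable_PiM_single')
    fix i
    show "(\<lambda>x. if i \<in> I then x i else 0) \<in> borel_measurable (PiM I (\<lambda>_. borel :: real measure))"
      by (cases "i \<in> I") auto
  qed auto
  have "(\<lambda>x. f (restrict (\<lambda>i. if i \<in> I then x i else 0) I)) \<in> borel_measurable (PiM I (\<lambda>_. borel))"
    using measurable_compose[OF e m] .
  moreover have "restrict (\<lambda>i. if i \<in> I then x i else 0) I = x"
    if "x \<in> space (PiM I (\<lambda>_. borel))" for x :: "nat \<Rightarrow> real"
    using that by (auto simp: space_PiM fun_eq_iff PiE_def extensional_def)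
  ultimately show ?thesis
    by (subst measurable_cong[where g = "\<lambda>x. f (restrict (\<lambda>i. if i \<in> I then x i else 0) I)"]) auto
qed

end

theory Submission
  imports Defs
begin

text \<open>
  Convergence is proved through joint Laplace transforms at integer exponents, that is, mixed moments of
  \<open>exp (- x i)\<close>, which determine weak limits of nonnegative vectors by Stone-Weierstrass.
  The Laplace transform of the last increments satisfies a backward recursion in the state (virtual
  vertices, virtual edges). Run the process until \<open>M\<close> virtual vertices remain, \<open>M\<close> large but fixed. By a
  second moment bound the number of virtual edges is then \<open>(M + 1) * N * ln N\<close> up to a relative error of
  order \<open>1 / sqrt M\<close>, and the at most \<open>M * N\<close> edges added afterwards are negligible. What is left is an
  urn without growth, whose transform is decreasing in the number of edges; so it can be compared with the
  same urn containing a negative binomial number of edges of slightly larger or smaller mean, where the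
  increments are exactly independent and geometric. Let \<open>N\<close> and then \<open>M\<close> tend to infinity.
\<close>

section \<open>Generating functions of the urn\<close>

text \<open>The scale comes from gaps: \<open>w\<close> virtual vertices cut the remaining
  selections into \<open>w + 1\<close> gaps, and a vertex selected while \<open>j\<close> remain
  adds \<open>N - j\<close> edges to be shared by the \<open>j\<close> gaps left. This is
  \<open>(N - j) / j\<close> per gap, a harmonic sum of order \<open>N * ln N\<close>. The obstacle
  is that for fixed \<open>M\<close> the edge count does not concentrate on this scale: up to the
  later growth it is the sum of the last \<open>M + 1\<close> increments, so by the theorem itself
  its limit is a Gamma law of relative deviation \<open>1 / sqrt (M + 1)\<close>. Hence
  \<open>M\<close> must tend to infinity although only \<open>m + 1\<close> increments are observed;
  the others get the weight 1. Both expectations are compared with the urn transform at that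
  threshold.\<close>

lemma state_induct:
  fixes w b :: nat
  assumes step: "\<And>w b. (b > 0 \<Longrightarrow> P w (b - 1)) \<Longrightarrow> (\<And>c. w > 0 \<Longrightarrow> P (w - 1) c) \<Longrightarrow> P w b"
  shows "P w b"
proof (induction w arbitrary: b)
  case 0
  show ?case by (induction b; rule step; simp)
next
  case (Suc w)
  show ?case by (induction b; rule step; simp add: Suc)
qed

text \<open>
  If each edge selected while \<open>w\<close> virtual vertices remain is given the weight \<open>z w\<close>, then
  \<open>pool_fun z a w b\<close> is the expected product of the weights of the edges still to be selected from a
  pool with \<open>w\<close> virtual vertices and \<open>b\<close> virtual edges, when selecting a vertex while \<open>w\<close> of them
  remain adds \<open>a w\<close> edges. The graph process has \<open>a w = N - w\<close>; \<open>a = 0\<close> is the urn without growth.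
\<close>

fun pool_fun :: "(nat \<Rightarrow> real) \<Rightarrow> (nat \<Rightarrow> nat) \<Rightarrow> nat \<Rightarrow> nat \<Rightarrow> real" where
  "pool_fun z a 0 0 = 1"
| "pool_fun z a 0 (Suc b) = z 0 * pool_fun z a 0 b"
| "pool_fun z a (Suc w) 0 = pool_fun z a w (a (Suc w))"
| "pool_fun z a (Suc w) (Suc b) =
     (real (Suc b) * z (Suc w) * pool_fun z a (Suc w) b
       + real (Suc w) * pool_fun z a w (Suc b + a (Suc w))) / real (Suc b + Suc w)"

text \<open>Clearing the denominator gives one formula for all states: at \<open>b = 0\<close> or
  \<open>w = 0\<close> the truncated predecessor is multiplied by 0.\<close>

lemma pool_fun_rec:
  "real (b + w) * pool_fun z a w b
     = real b * z w * pool_fun z a w (b - 1) + real w * pool_fun z a (w - 1) (b + a w)"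
  by (cases "(z, a, w, b)" rule: pool_fun.cases) (auto simp del: of_nat_Suc of_nat_add)

lemma le_if_scaled_le:
  fixes x y :: real
  assumes "b + w > 0" "real (b + w) * x \<le> real (b + w) * y"
  shows "x \<le> y"
  using assms by (metis mult_le_cancel_left_pos of_nat_0_less_iff)

section \<open>Weights in the half-open unit interval: monotonicity and the cost of added
  edges\<close>

locale weights =
  fixes z :: "nat \<Rightarrow> real"
  assumes z_pos: "\<And>i. 0 < z i" and z_le_1: "\<And>i. z i \<le> 1"
begin

lemma pool_fun_pos: "0 < pool_fun z a w b"
proof (induction w b rule: state_induct)
  case (1 w b)
  show ?case
  proof (cases "b + w > 0")
    case True
    have "0 < real b * (z w * pool_fun z a w (b - 1)) + real w * pool_fun z a (w - 1) (b + a w)"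
    proof (cases "b = 0")
      case False
      then show ?thesis
        using 1 z_pos[of w] by (cases "w = 0") (auto intro!: add_pos_nonneg mult_nonneg_nonneg less_imp_le)
    qed (use 1 True in auto)
    then show ?thesis
      using pool_fun_rec[of b w z a, symmetric] True by (simp add: zero_less_mult_iff mult.assoc split: if_splits)
  qed simp
qed

text \<open>The guards match the induction hypotheses of \<open>state_induct\<close>, so the
  boundary states \<open>b = 0\<close> and \<open>w = 0\<close> need no separate treatment.\<close>

lemma weighted_le:
  assumes "b > 0 \<Longrightarrow> x \<le> (x'::real)" "w > 0 \<Longrightarrow> y \<le> y'"
  shows "real b * z i * x + real w * y \<le> real b * z i * x' + real w * y'"
  using assms z_pos[of i] by (cases "b = 0"; cases "w = 0") (auto intro!: add_mono mult_left_mono)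

text \<open>Mark one of the \<open>Suc b\<close> edges. If it is selected first, it leaves
  \<open>b\<close> edges and a factor \<open>z w\<close>, which is at most 1; otherwise the step is
  that of the urn with \<open>b\<close> edges, the marked edge is still present, and the induction
  applies.\<close>

lemma pool_fun_le_no_growth: "pool_fun z (\<lambda>_. 0) w (Suc b) \<le> pool_fun z (\<lambda>_. 0) w b"
proof (induction w b rule: state_induct)
  case (1 w b)
  let ?U = "pool_fun z (\<lambda>_. 0)"
  have "real b * z w * ?U w b + real w * ?U (w - 1) (Suc b) \<le> real b * z w * ?U w (b-1) + real w * ?U (w - 1) b"
    by (rule weighted_le) (use 1 in \<open>auto dest!: gr0_implies_Suc\<close>)
  also have "\<dots> = real (b + w) * ?U w b"
    by (subst pool_fun_rec) simp
  finally have "real b * z w * ?U w b + real w * ?U (w - 1) (Suc b) \<le> real (b + w) * ?U w b" .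
  moreover have "z w * ?U w b \<le> 1 * ?U w b"
    using z_le_1 pool_fun_pos by (intro mult_right_mono) (auto intro: less_imp_le)
  moreover have "real (Suc b + w) * ?U w (Suc b) = z w * ?U w b + (real b * z w * ?U w b + real w * ?U (w - 1) (Suc b))"
    by (subst pool_fun_rec) (simp add: algebra_simps)
  ultimately have "real (Suc b + w) * ?U w (Suc b) \<le> real (Suc b + w) * ?U w b"
    by (simp add: algebra_simps)
  then show ?case
    by (rule le_if_scaled_le[rotated]) simp
qed

lemma pool_fun_no_growth_antimono:
  "b \<le> c \<Longrightarrow> pool_fun z (\<lambda>_. 0) w c \<le> pool_fun z (\<lambda>_. 0) w b"
  by (rule lift_Suc_antimono_le[of "pool_fun z (\<lambda>_. 0) w"]) (auto intro: pool_fun_le_no_growth)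

lemma pool_fun_no_growth_le_1: "pool_fun z (\<lambda>_. 0) w b \<le> 1"
proof -
  have "pool_fun z (\<lambda>_. 0) w b \<le> pool_fun z (\<lambda>_. 0) w 0"
    by (rule pool_fun_no_growth_antimono) simp
  also have "\<dots> = 1" by (induction w) auto
  finally show ?thesis .
qed

text \<open>The same marked edge: whenever it is selected, it contributes a factor of at least
  \<open>s\<close>.\<close>

lemma pool_fun_Suc_ge:
  assumes s: "0 \<le> s" "\<And>i. s \<le> z i"
  shows "s * pool_fun z (\<lambda>_. 0) w b \<le> pool_fun z (\<lambda>_. 0) w (Suc b)"
proof (induction w b rule: state_induct)
  case (1 w b)
  let ?U = "pool_fun z (\<lambda>_. 0)"
  have "real (b + w) * (s * ?U w b) = s * (real b * z w * ?U w (b - 1) + real w * ?U (w - 1) b)"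
    using pool_fun_rec[of b w z "\<lambda>_. 0"] by (simp add: mult.left_commute)
  also have "\<dots> = real b * z w * (s * ?U w (b - 1)) + real w * (s * ?U (w - 1) b)"
    by (simp add: algebra_simps)
  also have "\<dots> \<le> real b * z w * ?U w b + real w * ?U (w - 1) (Suc b)"
    by (rule weighted_le) (use 1 in \<open>auto dest!: gr0_implies_Suc\<close>)
  finally have "real (b + w) * (s * ?U w b) + s * ?U w b
      \<le> (real b * z w * ?U w b + real w * ?U (w - 1) (Suc b)) + z w * ?U w b"
    using s(2)[of w] pool_fun_pos[of "\<lambda>_. 0" w b] by (intro add_mono mult_right_mono) auto
  also have "\<dots> = real (Suc b + w) * ?U w (Suc b)"
    by (subst pool_fun_rec[of "Suc b"]) (simp add: algebra_simps)
  finally have "real (Suc b + w) * (s * ?U w b) \<le> real (Suc b + w) * ?U w (Suc b)"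
    by (simp add: algebra_simps)
  then show ?case
    by (rule le_if_scaled_le[rotated]) simp
qed

lemma pool_fun_add_ge:
  assumes s: "0 \<le> s" "\<And>i. s \<le> z i"
  shows "s ^ n * pool_fun z (\<lambda>_. 0) w b \<le> pool_fun z (\<lambda>_. 0) w (b + n)"
proof (induction n)
  case (Suc n)
  have "s ^ Suc n * pool_fun z (\<lambda>_. 0) w b \<le> s * pool_fun z (\<lambda>_. 0) w (b + n)"
    using Suc s by (simp add: mult.assoc mult_left_mono)
  also have "\<dots> \<le> pool_fun z (\<lambda>_. 0) w (b + Suc n)"
    using pool_fun_Suc_ge[OF s] by simp
  finally show ?case .
qed simp

lemma pool_fun_le_pool_fun_no_growth: "pool_fun z a w b \<le> pool_fun z (\<lambda>_. 0) w b"
proof (induction w b rule: state_induct)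
  case (1 w b)
  let ?U = "pool_fun z (\<lambda>_. 0)" and ?V = "pool_fun z a"
  show ?case
  proof (cases "b + w > 0")
    case True
    have "real (b + w) * ?V w b = real b * z w * ?V w (b - 1) + real w * ?V (w - 1) (b + a w)"
      by (rule pool_fun_rec)
    also have "\<dots> \<le> real b * z w * ?U w (b - 1) + real w * ?U (w - 1) b"
      by (rule weighted_le) (use 1 order_trans[OF 1(2) pool_fun_no_growth_antimono[of b "b + a w" "w - 1"]] in auto)
    also have "\<dots> = real (b + w) * ?U w b"
      by (subst pool_fun_rec) simp
    finally show ?thesis by (rule le_if_scaled_le[OF True])
  qed simp
qed

text \<open>Each of the \<open>w\<close> vertex selections adds at most \<open>n\<close> edges, and
  every added edge costs a factor no smaller than \<open>s\<close>.\<close>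

lemma pool_fun_ge_pool_fun_no_growth:
  assumes s: "0 \<le> s" "\<And>i. s \<le> z i" and a: "\<And>i. a i \<le> n"
  shows "s ^ (w * n) * pool_fun z (\<lambda>_. 0) w b \<le> pool_fun z a w b"
proof (induction w b rule: state_induct)
  case (1 w b)
  let ?U = "pool_fun z (\<lambda>_. 0)" and ?V = "pool_fun z a"
  have s1: "s \<le> 1" using s(2)[of 0] z_le_1[of 0] by linarith
  show ?case
  proof (cases "b + w > 0")
    case True
    have "real (b + w) * (s ^ (w * n) * ?U w b) = s ^ (w * n) * (real b * z w * ?U w (b - 1) + real w * ?U (w - 1) b)"
      using pool_fun_rec[of b w z "\<lambda>_. 0"] by (simp add: mult.left_commute)
    also have "\<dots> = real b * z w * (s ^ (w * n) * ?U w (b - 1)) + real w * (s ^ (w * n) * ?U (w - 1) b)"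
      by (simp add: algebra_simps)
    also have "\<dots> \<le> real b * z w * ?V w (b - 1) + real w * ?V (w - 1) (b + a w)"
    proof (rule weighted_le)
      assume w: "w > 0"
      have "s ^ (w * n) * ?U (w - 1) b = s ^ ((w - 1) * n) * (s ^ n * ?U (w - 1) b)"
        using w by (cases w) (auto simp: power_add)
      also have "\<dots> \<le> s ^ ((w - 1) * n) * (s ^ a w * ?U (w - 1) b)"
        using s s1 a pool_fun_pos[of "\<lambda>_. 0" "w - 1" b]
        by (intro mult_left_mono mult_right_mono power_decreasing) auto
      also have "\<dots> \<le> s ^ ((w - 1) * n) * ?U (w - 1) (b + a w)"
        using s by (intro mult_left_mono pool_fun_add_ge) auto
      also have "\<dots> \<le> ?V (w - 1) (b + a w)" using 1(2) w by auto
      finally show "s ^ (w * n) * ?U (w - 1) b \<le> ?V (w - 1) (b + a w)" .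
    qed (use 1 in auto)
    also have "\<dots> = real (b + w) * ?V w b"
      by (rule pool_fun_rec[symmetric])
    finally show ?thesis by (rule le_if_scaled_le[OF True])
  qed simp
qed

end

section \<open>Comparison with negative binomial mixtures\<close>

text \<open>\<open>f\<close> is the convolution of \<open>a\<close> with the powers of
  \<open>c\<close>, so the Cauchy product yields convergence and value at once.\<close>

lemma linear_recurrence_sums:
  fixes f a :: "nat \<Rightarrow> real"
  assumes a: "a sums A" "\<And>n. 0 \<le> a n" and c: "0 \<le> c" "c < 1"
    and f: "f 0 = a 0" "\<And>n. f (Suc n) = c * f n + a (Suc n)"
  shows "f sums (A / (1 - c))"
proof -
  have eq: "f n = (\<Sum>i\<le>n. c ^ i * a (n - i))" for n
  proof (induction n)
    case (Suc n)
    have "(\<Sum>i\<le>Suc n. c ^ i * a (Suc n - i)) = a (Suc n) + c * (\<Sum>i\<le>n. c ^ i * a (n - i))"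
      by (subst sum.atMost_Suc_shift) (simp add: sum_distrib_left mult.assoc)
    then show ?case using f Suc by simp
  qed (use f in simp)
  have "(\<lambda>n. \<Sum>i\<le>n. c ^ i * a (n - i)) sums ((\<Sum>i. c ^ i) * (\<Sum>i. a i))"
    using a c by (intro Cauchy_product_sums) (auto simp: sums_iff power_abs)
  moreover have "(\<Sum>i. c ^ i) = 1 / (1 - c)" "(\<Sum>i. a i) = A"
    using c a by (auto simp: suminf_geometric sums_iff)
  ultimately show ?thesis by (simp add: eq[abs_def])
qed

text \<open>Chebyshev's inequality in pointwise form: below the threshold the quadratic term is at
  least 1 and so dominates \<open>u b\<close>. In this form it can be propagated through the
  recursion of the process as well as averaged over negative binomial weights.\<close>

lemma le_antimono_add_square:
  fixes u :: "nat \<Rightarrow> real"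
  assumes u: "\<And>b c. b \<le> c \<Longrightarrow> u c \<le> u b" "\<And>b. 0 \<le> u b" "\<And>b. u b \<le> 1" and \<beta>: "0 \<le> \<beta>" "\<beta> < \<mu>"
  shows "u b \<le> u (nat \<lfloor>\<beta>\<rfloor>) + (real b - \<mu>)\<^sup>2 / (\<mu> - \<beta>)\<^sup>2"
proof (cases "nat \<lfloor>\<beta>\<rfloor> \<le> b")
  case True
  then show ?thesis using u(1)[OF True] by (simp add: add_increasing2)
next
  case False
  then have "real b \<le> \<beta>" using \<beta> by linarith
  then have "(\<mu> - \<beta>)\<^sup>2 \<le> (\<mu> - real b)\<^sup>2" using \<beta> by (intro power_mono) auto
  then have "1 \<le> (real b - \<mu>)\<^sup>2 / (\<mu> - \<beta>)\<^sup>2" using \<beta> by (simp add: power2_commute[of \<mu> "real b"])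
  then show ?thesis using u(2)[of "nat \<lfloor>\<beta>\<rfloor>"] u(3)[of b] by linarith
qed

lemma antimono_diff_square_le:
  fixes u :: "nat \<Rightarrow> real"
  assumes u: "\<And>b c. b \<le> c \<Longrightarrow> u c \<le> u b" "\<And>b. 0 \<le> u b" "\<And>b. u b \<le> 1" and \<beta>: "0 \<le> \<mu>" "\<mu> < \<beta>"
  shows "u (nat \<lfloor>\<beta>\<rfloor>) - (real b - \<mu>)\<^sup>2 / (\<beta> - \<mu>)\<^sup>2 \<le> u b"
proof (cases "b \<le> nat \<lfloor>\<beta>\<rfloor>")
  case True
  then show ?thesis using u(1)[OF True] by (simp add: algebra_simps add_increasing2)
next
  case False
  then have "\<beta> \<le> real b" using \<beta> by linarith
  then have "(\<beta> - \<mu>)\<^sup>2 \<le> (real b - \<mu>)\<^sup>2" using \<beta> by (intro power_mono) auto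
  then have "1 \<le> (real b - \<mu>)\<^sup>2 / (\<beta> - \<mu>)\<^sup>2" using \<beta> by simp
  then show ?thesis using u(3)[of "nat \<lfloor>\<beta>\<rfloor>"] u(2)[of b] by linarith
qed

text \<open>
  The law of a sum of \<open>w + 1\<close> independent geometric variables. With a negative binomial number
  of edges the urn without growth splits into independent geometric blocks, so its generating
  function becomes a product (\<open>nb_weight_pool_fun_sums\<close>).
\<close>

definition nb_weight :: "nat \<Rightarrow> real \<Rightarrow> nat \<Rightarrow> real" where
  "nb_weight w q b = real ((b + w) choose w) * q ^ b * (1 - q) ^ Suc w"

text \<open>The binomial coefficient counts the equally likely orders of edges and vertices. It
  absorbs the selection probabilities, which leaves a Pascal-type recurrence with coefficients
  independent of \<open>b\<close>.\<close>

lemma binomial_pool_fun_rec: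
  "real ((Suc b + Suc w) choose Suc w) * pool_fun z (\<lambda>_. 0) (Suc w) (Suc b)
     = z (Suc w) * (real ((b + Suc w) choose Suc w) * pool_fun z (\<lambda>_. 0) (Suc w) b)
       + real ((Suc b + w) choose w) * pool_fun z (\<lambda>_. 0) w (Suc b)"
proof -
  let ?n = "Suc b + w"
  have "(Suc ?n choose Suc w) * Suc b = Suc ?n * (?n choose Suc w)"
    using binomial_absorb_comp[of "Suc ?n" "Suc w"] by (simp add: mult.commute del: binomial_Suc_Suc)
  from arg_cong[OF this, of real]
  have 1: "real (Suc ?n choose Suc w) * real (Suc b) = real (Suc ?n) * real (?n choose Suc w)"
    by (simp only: of_nat_mult)
  from arg_cong[OF Suc_times_binomial_eq[of ?n w], of real]
  have 2: "real (Suc ?n choose Suc w) * real (Suc w) = real (Suc ?n) * real (?n choose w)"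
    by (simp only: of_nat_mult)
  have "real (Suc ?n choose Suc w) * pool_fun z (\<lambda>_. 0) (Suc w) (Suc b)
    = ((real (Suc ?n choose Suc w) * real (Suc b)) * z (Suc w) * pool_fun z (\<lambda>_. 0) (Suc w) b
       + (real (Suc ?n choose Suc w) * real (Suc w)) * pool_fun z (\<lambda>_. 0) w (Suc b)) / real (Suc ?n)"
    by (simp add: field_simps del: of_nat_Suc of_nat_add binomial_Suc_Suc)
  also have "\<dots> = z (Suc w) * (real (?n choose Suc w) * pool_fun z (\<lambda>_. 0) (Suc w) b)
       + real (?n choose w) * pool_fun z (\<lambda>_. 0) w (Suc b)"
    unfolding 1 2 by (simp add: field_simps del: of_nat_Suc of_nat_add binomial_Suc_Suc)
  finally show ?thesis by simp
qed

context weights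
begin

text \<open>The binomial coefficient times \<open>pool_fun\<close> is the complete homogeneous
  symmetric polynomial of degree \<open>b\<close> in \<open>z 0, ..., z w\<close>; its generating
  function is this product, each level contributing one geometric series.\<close>

lemma binomial_pool_fun_sums:
  assumes q: "0 \<le> q" "q < 1"
  shows "(\<lambda>b. real ((b + w) choose w) * pool_fun z (\<lambda>_. 0) w b * q ^ b) sums (\<Prod>j\<le>w. 1 / (1 - q * z j))"
proof (induction w)
  case 0
  have "pool_fun z (\<lambda>_. 0) 0 b = z 0 ^ b" for b by (induction b) auto
  moreover have "q * z 0 < 1" using q z_le_1[of 0] z_pos[of 0] by (smt (verit) mult_left_le)
  ultimately show ?case
    using geometric_sums[of "q * z 0"] q z_pos[of 0] by (simp add: power_mult_distrib mult.commute)
next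
  case (Suc w)
  have "q * z (Suc w) < 1" using q z_le_1[of "Suc w"] z_pos[of "Suc w"] by (smt (verit) mult_left_le)
  have "(\<lambda>b. real ((b + Suc w) choose Suc w) * pool_fun z (\<lambda>_. 0) (Suc w) b * q ^ b)
     sums ((\<Prod>j\<le>w. 1 / (1 - q * z j)) / (1 - q * z (Suc w)))"
  proof (rule linear_recurrence_sums[OF Suc])
    fix n
    show "real ((Suc n + Suc w) choose Suc w) * pool_fun z (\<lambda>_. 0) (Suc w) (Suc n) * q ^ Suc n
      = q * z (Suc w) * (real ((n + Suc w) choose Suc w) * pool_fun z (\<lambda>_. 0) (Suc w) n * q ^ n)
        + real ((Suc n + w) choose w) * pool_fun z (\<lambda>_. 0) w (Suc n) * q ^ Suc n"
      unfolding binomial_pool_fun_rec by (simp only: power_Suc) (simp only: algebra_simps)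
  qed (use q z_pos[of "Suc w"] pool_fun_pos[of "\<lambda>_. 0" w] \<open>q * z (Suc w) < 1\<close> in
      \<open>auto simp: less_imp_le intro!: mult_nonneg_nonneg\<close>)
  then show ?case by simp
qed

text \<open>The parametrisation \<open>q = g / (1 + g)\<close> gives every geometric block the mean
  \<open>g\<close> and the generating function \<open>1 / (1 + g * (1 - z j))\<close>, which becomes
  an exponential Laplace transform when \<open>g * (1 - z j)\<close> converges.\<close>

lemma nb_weight_pool_fun_sums:
  assumes g: "0 \<le> g"
  shows "(\<lambda>b. nb_weight w (g / (1 + g)) b * pool_fun z (\<lambda>_. 0) w b) sums (\<Prod>j\<le>w. 1 / (1 + g * (1 - z j)))"
proof -
  define q where "q = g / (1 + g)"
  have q: "0 \<le> q" "q < 1" using g by (auto simp: q_def)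
  have "(\<lambda>b. (1 - q) ^ Suc w * (real ((b + w) choose w) * pool_fun z (\<lambda>_. 0) w b * q ^ b))
     sums ((1 - q) ^ Suc w * (\<Prod>j\<le>w. 1 / (1 - q * z j)))"
    using binomial_pool_fun_sums[OF q] by (rule sums_mult)
  also have "(1 - q) ^ Suc w * (\<Prod>j\<le>w. 1 / (1 - q * z j)) = (\<Prod>j\<le>w. (1 - q) * (1 / (1 - q * z j)))"
    by (simp only: prod.distrib prod_constant card_atMost)
  also have "\<dots> = (\<Prod>j\<le>w. 1 / (1 + g * (1 - z j)))"
  proof (rule prod.cong)
    fix j
    have "1 - q = 1 / (1 + g)" "1 - q * z j = (1 + g * (1 - z j)) / (1 + g)"
      using g by (auto simp: q_def field_simps)
    then show "(1 - q) * (1 / (1 - q * z j)) = 1 / (1 + g * (1 - z j))" using g by simp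
  qed simp
  finally show ?thesis unfolding nb_weight_def q_def by (simp add: mult_ac)
qed

end

text \<open>With all weights equal to 1 the transform is 1, so normalisation is a special case of
  \<open>nb_weight_pool_fun_sums\<close>.\<close>

lemma nb_weight_sums:
  assumes g: "0 \<le> g"
  shows "nb_weight w (g / (1 + g)) sums 1"
proof -
  interpret weights "\<lambda>_. 1" by unfold_locales auto
  have "pool_fun (\<lambda>_. 1) (\<lambda>_. 0) w b = 1" for b
  proof (induction w b rule: state_induct)
    case (1 w b)
    show ?case
    proof (cases "b + w > 0")
      case True
      have "real (b + w) * pool_fun (\<lambda>_. 1) (\<lambda>_. 0) w b = real (b + w) * 1"
        by (subst pool_fun_rec) (use 1 in \<open>cases "b = 0"; cases "w = 0"; simp\<close>)
      then show ?thesis using True by (metis mult_cancel_left of_nat_0_eq_iff less_not_refl)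
    qed simp
  qed
  then show ?thesis using nb_weight_pool_fun_sums[OF g, of w] by simp
qed

text \<open>Size biasing turns \<open>w + 1\<close> geometric blocks into \<open>w + 2\<close>. The
  first two factorial moments then follow from normalisation, without differentiating power
  series.\<close>

lemma nb_weight_Suc:
  assumes "0 \<le> g"
  shows "real (Suc b) * nb_weight w (g / (1 + g)) (Suc b) = real (Suc w) * g * nb_weight (Suc w) (g / (1 + g)) b"
proof -
  define q where "q = g / (1 + g)"
  have gq: "g * (1 - q) = q" using assms by (simp add: q_def field_simps)
  have "Suc b * ((Suc b + w) choose w) = Suc w * ((b + Suc w) choose Suc w)"
    using binomial_absorb_comp[of "Suc b + w" w] Suc_times_binomial_eq[of "b + w" w]
    by (simp add: mult.commute del: binomial_Suc_Suc)
  from arg_cong[OF this, of real]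
  have "real (Suc b) * real ((Suc b + w) choose w) = real (Suc w) * real ((b + Suc w) choose Suc w)"
    by (simp only: of_nat_mult)
  then have "real (Suc b) * nb_weight w q (Suc b) = real (Suc w) * real ((b + Suc w) choose Suc w) * q ^ b * (1 - q) ^ Suc w * (g * (1 - q))"
    unfolding nb_weight_def gq by (simp add: mult_ac)
  then show ?thesis unfolding nb_weight_def q_def[symmetric] by (simp add: mult_ac)
qed

lemma nb_weight_mean_sums:
  assumes g: "0 \<le> g"
  shows "(\<lambda>b. real b * nb_weight w (g / (1 + g)) b) sums (real (Suc w) * g)"
proof -
  have "(\<lambda>b. real (Suc b) * nb_weight w (g / (1 + g)) (Suc b)) sums (real (Suc w) * g * 1)"
    unfolding nb_weight_Suc[OF g] by (intro sums_mult nb_weight_sums g)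
  then show ?thesis by (subst (asm) sums_Suc_iff) simp
qed

lemma nb_weight_variance_sums:
  assumes g: "0 \<le> g"
  shows "(\<lambda>b. nb_weight w (g / (1 + g)) b * (real b - real (Suc w) * g)\<^sup>2) sums (real (Suc w) * (g\<^sup>2 + g))"
proof -
  let ?nb = "nb_weight w (g / (1 + g))" and ?\<mu> = "real (Suc w) * g"
  have "(\<lambda>b. real b * (real (Suc b) * ?nb (Suc b))) sums (?\<mu> * (real (Suc (Suc w)) * g))"
    unfolding nb_weight_Suc[OF g] using sums_mult[OF nb_weight_mean_sums[OF g, of "Suc w"], of ?\<mu>]
    by (simp add: mult_ac)
  then have "(\<lambda>b. real (b - 1) * (real b * ?nb b)) sums (?\<mu> * (real (Suc (Suc w)) * g))"
    using sums_Suc_iff[where f = "\<lambda>b. real (b - 1) * (real b * ?nb b)"] by simp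
  from sums_add[OF sums_add[OF this sums_mult[OF nb_weight_mean_sums[OF g, of w], of "1 - 2 * ?\<mu>"]]
      sums_mult[OF nb_weight_sums[OF g, of w], of "?\<mu>\<^sup>2"]]
  have "(\<lambda>b. real (b - 1) * (real b * ?nb b) + (1 - 2 * ?\<mu>) * (real b * ?nb b) + ?\<mu>\<^sup>2 * ?nb b)
      sums (?\<mu> * (real (Suc (Suc w)) * g) + (1 - 2 * ?\<mu>) * ?\<mu> + ?\<mu>\<^sup>2 * 1)" .
  moreover have "real (b - 1) * (real b * ?nb b) + (1 - 2 * ?\<mu>) * (real b * ?nb b) + ?\<mu>\<^sup>2 * ?nb b
      = ?nb b * (real b - ?\<mu>)\<^sup>2" for b
    by (cases b) (auto simp: power2_eq_square algebra_simps)
  moreover have "?\<mu> * (real (Suc (Suc w)) * g) + (1 - 2 * ?\<mu>) * ?\<mu> + ?\<mu>\<^sup>2 * 1 = real (Suc w) * (g\<^sup>2 + g)"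
    by (simp add: power2_eq_square algebra_simps)
  ultimately show ?thesis by simp
qed

lemma nb_weight_nonneg: "0 \<le> g \<Longrightarrow> 0 \<le> nb_weight w (g / (1 + g)) b"
  by (simp add: nb_weight_def field_simps)

text \<open>The sign of \<open>s\<close> is free: \<open>s = -1\<close> turns lower bounds for
  \<open>u\<close> into one for its mean \<open>m\<close>, while a positive \<open>s\<close> carries
  the factor lost to growth.\<close>

lemma nb_weight_chebyshev:
  assumes g: "0 \<le> g" and u: "(\<lambda>b. nb_weight w (g / (1 + g)) b * u b) sums m"
    and le: "\<And>b. s * u b \<le> \<alpha> + c * (real b - real (Suc w) * g)\<^sup>2"
  shows "s * m \<le> \<alpha> + c * (real (Suc w) * (g\<^sup>2 + g))"
proof -
  let ?nb = "nb_weight w (g / (1 + g))"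
  have "(\<lambda>b. \<alpha> * ?nb b + c * (?nb b * (real b - real (Suc w) * g)\<^sup>2)) sums (\<alpha> * 1 + c * (real (Suc w) * (g\<^sup>2 + g)))"
    by (intro sums_add sums_mult nb_weight_sums nb_weight_variance_sums g)
  moreover have "s * (?nb b * u b) \<le> \<alpha> * ?nb b + c * (?nb b * (real b - real (Suc w) * g)\<^sup>2)" for b
    using mult_left_mono[OF le[of b] nb_weight_nonneg[OF g, of w b]] by (simp add: algebra_simps)
  ultimately show ?thesis using sums_le[OF _ sums_mult[OF u, of s]] by fastforce
qed


text \<open>
  Starting from \<open>b\<close> virtual edges and \<open>w\<close> virtual vertices, the mean number of virtual edges when only
  \<open>M\<close> virtual vertices remain is \<open>(M + 1) * (b / (w + 1) + drift N M w)\<close>, and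
  \<open>(M + 1) * (M + 2) * sq_majorant N M w b\<close> bounds its second factorial moment.
\<close>

definition drift :: "nat \<Rightarrow> nat \<Rightarrow> nat \<Rightarrow> real" where
  "drift N M w = (\<Sum>j\<in>{M<..w}. real (N - j) / real j)"

lemma drift_Suc: "M \<le> w \<Longrightarrow> drift N M (Suc w) = drift N M w + real (N - Suc w) / real (Suc w)"
  unfolding drift_def by (subst atLeastSucAtMost_greaterThanAtMost[symmetric])+ (simp add: atLeastAtMostSuc_conv)

definition sq_majorant :: "nat \<Rightarrow> nat \<Rightarrow> nat \<Rightarrow> nat \<Rightarrow> real" where
  "sq_majorant N M w b = real b * (real b - 1) / (real (w + 1) * real (w + 2))
     + 2 * drift N M w * real b / real (w + 1) + (drift N M w)\<^sup>2"

text \<open>A supermartingale property. Without growth,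
  \<open>b * (b - 1) / ((w + 1) * (w + 2))\<close> and \<open>b / (w + 1)\<close> are martingales;
  \<open>sq_majorant\<close> combines them in imitation of the square of
  \<open>b / (w + 1) + drift N M w\<close>.\<close>

lemma sq_majorant_step:
  assumes w: "M < w" "w \<le> N"
  shows "real b * sq_majorant N M w (b - 1) + real w * sq_majorant N M (w - 1) (b + (N - w))
     \<le> real (b + w) * sq_majorant N M w b"
proof -
  define n where "n = N - w"
  define x y where "x = real b" and "y = real w"
  define S where "S = drift N M (w - 1)"
  have y: "y > 0" "y \<ge> 1" using w by (auto simp: y_def)
  have S: "drift N M w = S + real n / y"
    using drift_Suc[of M "w - 1" N] w by (simp add: S_def n_def y_def)
  have b1: "real b * (real (b - 1) * (real (b - 1) - 1)) = x * ((x - 1) * (x - 2))"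
           "real b * real (b - 1) = x * (x - 1)"
    by (cases b; simp add: x_def)+
  have w2: "real (w + 1) = y + 1" "real (w + 2) = y + 2" by (auto simp: y_def)
  have w1: "real (w - 1 + 1) = y" "real (w - 1 + 2) = y + 1" using w by (auto simp: y_def)
  have "real b * sq_majorant N M w (b - 1) = x * ((x - 1) * (x - 2)) / ((y + 1) * (y + 2))
      + 2 * (S + real n / y) * (x * (x - 1)) / (y + 1) + x * (S + real n / y)\<^sup>2"
    unfolding sq_majorant_def S w2 b1[symmetric] by (simp add: x_def[symmetric] distrib_left mult_ac)
  moreover have "real w * sq_majorant N M (w - 1) (b + (N - w))
     = y * ((x + n) * (x + n - 1) / (y * (y + 1)) + 2 * S * (x + n) / y + S\<^sup>2)"
    unfolding sq_majorant_def w1 S_def[symmetric] n_def[symmetric] by (simp add: x_def y_def)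
  moreover have "real (b + w) * sq_majorant N M w b
     = (x + y) * (x * (x - 1) / ((y + 1) * (y + 2)) + 2 * (S + real n / y) * x / (y + 1) + (S + real n / y)\<^sup>2)"
    unfolding sq_majorant_def S by (simp add: x_def y_def add_ac)
  \<comment> \<open>The term subtracted on the last line is the expected loss in one selection times
    the pool size; only its sign matters.\<close>
  moreover have "x * ((x - 1) * (x - 2)) / ((y + 1) * (y + 2))
      + 2 * (S + real n / y) * (x * (x - 1)) / (y + 1) + x * (S + real n / y)\<^sup>2
      + y * ((x + n) * (x + n - 1) / (y * (y + 1)) + 2 * S * (x + n) / y + S\<^sup>2)
      = (x + y) * (x * (x - 1) / ((y + 1) * (y + 2)) + 2 * (S + real n / y) * x / (y + 1) + (S + real n / y)\<^sup>2)
       - ((2 * real n * x + (real n)\<^sup>2) / (y * (y + 1)) + real n / (y + 1))"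
    using y by (simp add: divide_simps) (simp add: algebra_simps power2_eq_square)
  moreover have "0 \<le> (2 * real n * x + (real n)\<^sup>2) / (y * (y + 1)) + real n / (y + 1)"
    using y by (simp add: x_def)
  ultimately show ?thesis by linarith
qed

text \<open>The martingale behind the mean: a vertex selected while \<open>w\<close> remain adds
  \<open>(N - w) / w\<close> edges per gap, exactly the amount by which \<open>drift\<close>
  drops.\<close>

lemma mean_step:
  assumes w: "M < w" "w \<le> N"
  shows "real b * (real (b - 1) / real (w + 1) + drift N M w)
       + real w * (real (b + (N - w)) / real w + drift N M (w - 1))
     = real (b + w) * (real b / real (w + 1) + drift N M w)"
proof -
  define x y n D where "x = real b" and "y = real w" and "n = real (N - w)" and "D = drift N M (w - 1)"
  have y: "y > 0" using w by (simp add: y_def)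
  have drift: "drift N M w = D + n / y"
    using drift_Suc[of M "w - 1" N] w by (simp add: n_def y_def D_def)
  have xb: "x * real (b - 1) = x * (x - 1)" by (cases b) (auto simp: x_def)
  have "x * (real (b - 1) / (y + 1) + (D + n / y)) + y * ((x + n) / y + D)
      = (x * (x - 1)) / (y + 1) + x * (D + n / y) + y * ((x + n) / y + D)"
    unfolding xb[symmetric] by (simp add: algebra_simps)
  also have "\<dots> = (x + y) * (x / (y + 1) + (D + n / y))"
    using y by (simp add: divide_simps) (simp add: algebra_simps)
  finally have "x * (real (b - 1) / (y + 1) + (D + n / y)) + y * ((x + n) / y + D)
      = (x + y) * (x / (y + 1) + (D + n / y))" .
  then show ?thesis
    unfolding of_nat_add D_def[symmetric] drift by (simp add: x_def y_def n_def)
qed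

text \<open>\<open>f\<close> is a subsolution of the recursion. At level \<open>M\<close> it lies
  below a multiple of a supersolution, and this order persists up to the initial state, where the
  supersolution bounds the variance of the edge count at level \<open>M\<close>.\<close>

lemma square_majorization:
  fixes f :: "nat \<Rightarrow> nat \<Rightarrow> real"
  assumes MN: "M \<le> N" and c: "0 \<le> c"
    and f: "\<And>w b. M < w \<Longrightarrow> w \<le> N \<Longrightarrow>
      real (b + w) * f w b \<le> real b * f w (b - 1) + real w * f (w - 1) (b + (N - w))"
    and fM: "\<And>b. f M b \<le> c * (real b - real (Suc M) * drift N M N)\<^sup>2"
  shows "f N 0 \<le> c * (real (Suc M) * ((drift N M N)\<^sup>2 + drift N M N))"
proof -
  define \<mu> where "\<mu> = real (Suc M) * drift N M N"
  \<comment> \<open>Since \<open>b * (b - 1) + (1 - 2 * \<mu>) * b + \<mu>\<^sup>2\<close> is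
    \<open>(b - \<mu>)\<^sup>2\<close>, this is the squared deviation at \<open>w = M\<close>. The
    coefficient \<open>1 - 2 * \<mu>\<close> may be negative, so the mean has to enter through an
    identity; an inequality suffices for \<open>sq_majorant\<close>, whose coefficient is
    positive.\<close>
  define R where "R w b = real (M + 1) * real (M + 2) * sq_majorant N M w b
    + (1 - 2 * \<mu>) * real (M + 1) * (real b / real (w + 1) + drift N M w) + \<mu>\<^sup>2" for w b
  have d0: "drift N M M = 0" by (simp add: drift_def)
  have R_step: "real b * R w (b - 1) + real w * R (w - 1) (b + (N - w)) \<le> real (b + w) * R w b"
    if w: "M < w" "w \<le> N" for w b
  proof -
    define p where "p = real (M + 1) * real (M + 2)"
    define r where "r = (1 - 2 * \<mu>) * real (M + 1)"
    have eq: "real (w - 1 + 1) = real w" using w by simp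
    have "p * (real b * sq_majorant N M w (b - 1) + real w * sq_majorant N M (w - 1) (b + (N - w)))
      \<le> p * (real (b + w) * sq_majorant N M w b)"
      using sq_majorant_step[OF w] by (intro mult_left_mono) (auto simp: p_def)
    moreover have "r * (real b * (real (b - 1) / real (w + 1) + drift N M w)
       + real w * (real (b + (N - w)) / real w + drift N M (w - 1)))
      = r * (real (b + w) * (real b / real (w + 1) + drift N M w))"
      unfolding mean_step[OF w] ..
    ultimately show ?thesis
      unfolding R_def p_def[symmetric] r_def[symmetric] eq of_nat_add[of b w] by (simp only: algebra_simps)
  qed
  have RM: "R M b = (real b - \<mu>)\<^sup>2" for b
    unfolding R_def sq_majorant_def d0 by (simp add: divide_simps) (simp add: algebra_simps power2_eq_square)
  have "M \<le> w \<Longrightarrow> w \<le> N \<Longrightarrow> f w b \<le> c * R w b" for w b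
  proof (induction w b rule: state_induct)
    case (1 w b)
    show ?case
    proof (cases "w = M")
      case True
      then show ?thesis using fM RM by (simp add: \<mu>_def)
    next
      case False
      then have w: "M < w" "w \<le> N" using 1 by auto
      have "real (b + w) * f w b \<le> real b * f w (b - 1) + real w * f (w - 1) (b + (N - w))"
        using f[OF w] .
      also have "\<dots> \<le> real b * (c * R w (b - 1)) + real w * (c * R (w - 1) (b + (N - w)))"
        using 1 w by (intro add_mono) (cases "b = 0"; simp add: mult_left_mono)+
      also have "\<dots> = c * (real b * R w (b - 1) + real w * R (w - 1) (b + (N - w)))"
        by (simp add: algebra_simps)
      also have "\<dots> \<le> c * (real (b + w) * R w b)"
        using R_step[OF w] c by (rule mult_left_mono)
      finally have "real (b + w) * f w b \<le> real (b + w) * (c * R w b)" by (simp only: mult_ac)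
      then show ?thesis by (rule le_if_scaled_le[rotated]) (use w in simp)
    qed
  qed
  from this[OF MN order_refl] have "f N 0 \<le> c * R N 0" .
  also have "R N 0 = real (Suc M) * ((drift N M N)\<^sup>2 + drift N M N)"
    unfolding R_def sq_majorant_def \<mu>_def by (simp add: algebra_simps power2_eq_square)
  finally show ?thesis .
qed

text \<open>The two summands are Chebyshev errors, for the process and for \<open>K\<close>
  geometric blocks of mean \<open>t * S\<close>, with a threshold at distance
  \<open>K * (\<delta> * S)\<close> from both means. The scale \<open>S\<close> cancels in the
  leading term and leaves an error of order \<open>1 / (K * \<delta>\<^sup>2)\<close>.\<close>

lemma chebyshev_error_eq:
  fixes K S \<delta> :: real
  assumes "0 < K" "0 < S" "0 < \<delta>"
  shows "c / (K * (\<delta> * S))\<^sup>2 * (K * (S\<^sup>2 + S)) + c / (K * (\<delta> * S))\<^sup>2 * (K * ((t * S)\<^sup>2 + t * S))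
    = c * ((t\<^sup>2 + t / S + (1 + 1 / S)) / (K * \<delta>\<^sup>2))"
proof -
  have eq: "c / (K * (\<delta> * S))\<^sup>2 * (K * ((t * S)\<^sup>2 + t * S)) = c * ((t\<^sup>2 + t / S) / (K * \<delta>\<^sup>2))" for t
  proof -
    have "(t * S)\<^sup>2 + t * S = (t\<^sup>2 + t / S) * S\<^sup>2"
      using assms by (simp add: distrib_right power_mult_distrib power2_eq_square)
    moreover have "(K * (\<delta> * S))\<^sup>2 = (K * \<delta>\<^sup>2) * (K * S\<^sup>2)"
      by (simp add: power2_eq_square)
    ultimately show ?thesis using assms by simp
  qed
  from eq[of 1] eq[of t] show ?thesis
    by (simp add: add_divide_distrib distrib_left)
qed

section \<open>Two-sided bounds for the process by negative binomial urns\<close>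

context weights
begin

text \<open>Above level \<open>M\<close> all weights are 1, so there the recursion is a plain
  conditional expectation and preserves constants; both halves apply
  \<open>square_majorization\<close> to the difference from \<open>\<alpha>\<close>.\<close>

lemma pool_fun_initial_bounds:
  assumes MN: "M \<le> N" and z1: "\<And>w. M < w \<Longrightarrow> z w = 1" and c: "0 \<le> c"
    and S: "S = drift N M N"
  shows "(\<And>b. \<alpha> - c * (real b - real (Suc M) * S)\<^sup>2 \<le> pool_fun z (\<lambda>w. N - w) M b)
      \<Longrightarrow> \<alpha> - c * (real (Suc M) * (S\<^sup>2 + S)) \<le> pool_fun z (\<lambda>w. N - w) N 0"
    and "(\<And>b. pool_fun z (\<lambda>w. N - w) M b \<le> \<alpha> + c * (real b - real (Suc M) * S)\<^sup>2)
      \<Longrightarrow> pool_fun z (\<lambda>w. N - w) N 0 \<le> \<alpha> + c * (real (Suc M) * (S\<^sup>2 + S))"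
proof -
  let ?V = "pool_fun z (\<lambda>w. N - w)"
  have rec: "real (b + w) * ?V w b = real b * ?V w (b - 1) + real w * ?V (w - 1) (b + (N - w))"
    if "M < w" for w b
    by (subst pool_fun_rec) (simp add: z1[OF that])
  have rec': "real b * x + real w * y - real b * \<alpha> - real w * \<alpha> = real b * (x - \<alpha>) + real w * (y - \<alpha>)" for b w x y
    by (simp add: algebra_simps)
  {
    assume *: "\<And>b. \<alpha> - c * (real b - real (Suc M) * S)\<^sup>2 \<le> ?V M b"
    have "\<alpha> - ?V N 0 \<le> c * (real (Suc M) * ((drift N M N)\<^sup>2 + drift N M N))"
    proof (rule square_majorization[OF MN c, of "\<lambda>w b. \<alpha> - ?V w b"])
      fix w b assume "M < w"
      then show "real (b + w) * (\<alpha> - ?V w b) \<le> real b * (\<alpha> - ?V w (b - 1)) + real w * (\<alpha> - ?V (w - 1) (b + (N - w)))"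
        using rec[of w b] by (simp add: right_diff_distrib) (simp add: algebra_simps)
    next
      fix b show "\<alpha> - ?V M b \<le> c * (real b - real (Suc M) * drift N M N)\<^sup>2"
        using *[of b] unfolding S by linarith
    qed
    then show "\<alpha> - c * (real (Suc M) * (S\<^sup>2 + S)) \<le> ?V N 0" unfolding S by linarith
  }
  {
    assume *: "\<And>b. ?V M b \<le> \<alpha> + c * (real b - real (Suc M) * S)\<^sup>2"
    have "?V N 0 - \<alpha> \<le> c * (real (Suc M) * ((drift N M N)\<^sup>2 + drift N M N))"
    proof (rule square_majorization[OF MN c, of "\<lambda>w b. ?V w b - \<alpha>"])
      fix w b assume "M < w"
      then show "real (b + w) * (?V w b - \<alpha>) \<le> real b * (?V w (b - 1) - \<alpha>) + real w * (?V (w - 1) (b + (N - w)) - \<alpha>)"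
        using rec[of w b] by (simp add: right_diff_distrib) (simp add: algebra_simps)
    next
      fix b show "?V M b - \<alpha> \<le> c * (real b - real (Suc M) * drift N M N)\<^sup>2"
        using *[of b] unfolding S by linarith
    qed
    then show "?V N 0 \<le> \<alpha> + c * (real (Suc M) * (S\<^sup>2 + S))" unfolding S by linarith
  }
qed

text \<open>The count of the process rarely falls below the threshold \<open>\<beta>\<close>, and
  the negative binomial count rarely exceeds it. So \<open>\<alpha>\<close> nearly bounds the first
  transform from above and the second from below.\<close>

lemma pool_fun_initial_le:
  assumes MN: "M \<le> N" and z1: "\<And>w. M < w \<Longrightarrow> z w = 1" 
    and S: "S = drift N M N" "0 < S" and \<delta>: "0 < \<delta>" "\<delta> \<le> 1/2"
  shows "pool_fun z (\<lambda>w. N - w) N 0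
    \<le> (\<Prod>j\<le>M. 1 / (1 + (1 - 2 * \<delta>) * S * (1 - z j)))
      + (((1 - 2 * \<delta>)\<^sup>2 + (1 - 2 * \<delta>) / S) + (1 + 1 / S)) / (real (Suc M) * \<delta>\<^sup>2)"
proof -
  define g where "g = (1 - 2 * \<delta>) * S"
  define K where "K = real (Suc M)"
  \<comment> \<open>Halfway between the negative binomial mean \<open>K * g\<close> and the mean
    \<open>K * S\<close> of the process.\<close>
  define \<beta> where "\<beta> = K * ((1 - \<delta>) * S)"
  define \<alpha> where "\<alpha> = pool_fun z (\<lambda>_. 0) M (nat \<lfloor>\<beta>\<rfloor>)"
  have K: "K > 0" by (simp add: K_def)
  have g: "0 \<le> g" "K * g < \<beta>" "0 \<le> K * g" and \<beta>: "0 \<le> \<beta>" "\<beta> < K * S"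
    using \<delta> S K by (auto simp: g_def \<beta>_def)
  have d: "\<beta> - K * g = K * (\<delta> * S)" "K * S - \<beta> = K * (\<delta> * S)"
    by (auto simp: \<beta>_def g_def algebra_simps)
  note U = pool_fun_no_growth_antimono[where w = M] less_imp_le[OF pool_fun_pos[of "\<lambda>_. 0" M]] pool_fun_no_growth_le_1[of M]
  have upper: "pool_fun z (\<lambda>w. N - w) N 0 \<le> \<alpha> + 1 / (real (Suc M) * (\<delta> * S))\<^sup>2 * (real (Suc M) * (S\<^sup>2 + S))"
  proof (rule pool_fun_initial_bounds(2)[OF MN z1 _ S(1)])
    fix b
    have "pool_fun z (\<lambda>w. N - w) M b \<le> pool_fun z (\<lambda>_. 0) M b"
      by (rule pool_fun_le_pool_fun_no_growth)
    also have "\<dots> \<le> \<alpha> + 1 / (real (Suc M) * (\<delta> * S))\<^sup>2 * (real b - real (Suc M) * S)\<^sup>2"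
      using le_antimono_add_square[of "pool_fun z (\<lambda>_. 0) M", OF U \<beta>, of b] unfolding K_def[symmetric] d \<alpha>_def by simp
    finally show "pool_fun z (\<lambda>w. N - w) M b \<le> \<alpha> + 1 / (real (Suc M) * (\<delta> * S))\<^sup>2 * (real b - real (Suc M) * S)\<^sup>2" .
  qed auto
  have nb: "-1 * (\<Prod>j\<le>M. 1 / (1 + g * (1 - z j))) \<le> - \<alpha> + 1 / (real (Suc M) * (\<delta> * S))\<^sup>2 * (real (Suc M) * (g\<^sup>2 + g))"
  proof (rule nb_weight_chebyshev[OF g(1) nb_weight_pool_fun_sums[OF g(1)]])
    fix b
    show "-1 * pool_fun z (\<lambda>_. 0) M b \<le> -\<alpha> + 1 / (real (Suc M) * (\<delta> * S))\<^sup>2 * (real b - real (Suc M) * g)\<^sup>2"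
      using antimono_diff_square_le[of "pool_fun z (\<lambda>_. 0) M", OF U g(3,2), of b] unfolding K_def[symmetric] d \<alpha>_def by simp
  qed
  have combine: "V \<le> P + E" if "V \<le> a + t1" "-1 * P \<le> - a + t2" "t1 + t2 = 1 * E" for V P E a t1 t2 :: real
    using that by linarith
  show ?thesis
    using combine[OF upper nb chebyshev_error_eq[OF K S(2) \<delta>(1), of 1 "1 - 2 * \<delta>", folded g_def, unfolded K_def]]
    unfolding g_def .
qed

text \<open>The mirror image, with the negative binomial mean above that of the process. Growth
  after level \<open>M\<close> now works against the bound; its at most \<open>M * N\<close> edges
  account for the factor \<open>s ^ (M * N)\<close>.\<close>

lemma pool_fun_initial_ge:
  assumes MN: "M \<le> N" and z1: "\<And>w. M < w \<Longrightarrow> z w = 1" and s: "0 \<le> s" "\<And>i. s \<le> z i"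
    and S: "S = drift N M N" "0 < S" and \<delta>: "0 < \<delta>"
  shows "s ^ (M * N) * (\<Prod>j\<le>M. 1 / (1 + (1 + 2 * \<delta>) * S * (1 - z j)))
      - (((1 + 2 * \<delta>)\<^sup>2 + (1 + 2 * \<delta>) / S) + (1 + 1 / S)) / (real (Suc M) * \<delta>\<^sup>2)
    \<le> pool_fun z (\<lambda>w. N - w) N 0"
proof -
  define g where "g = (1 + 2 * \<delta>) * S"
  define K where "K = real (Suc M)"
  define \<beta> where "\<beta> = K * ((1 + \<delta>) * S)"
  define \<alpha> where "\<alpha> = pool_fun z (\<lambda>_. 0) M (nat \<lfloor>\<beta>\<rfloor>)"
  define r where "r = s ^ (M * N)"
  have r: "0 \<le> r" "r \<le> 1" using s(1) s(2)[of 0] z_le_1[of 0] by (auto simp: r_def intro!: power_le_one)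
  have K: "K > 0" by (simp add: K_def)
  have g: "0 \<le> g" "\<beta> < K * g" and \<beta>: "0 \<le> \<beta>" "K * S < \<beta>" "0 \<le> K * S"
    using \<delta> S K by (auto simp: g_def \<beta>_def)
  have d: "K * g - \<beta> = K * (\<delta> * S)" "\<beta> - K * S = K * (\<delta> * S)"
    by (auto simp: \<beta>_def g_def algebra_simps)
  note U = pool_fun_no_growth_antimono[where w = M] less_imp_le[OF pool_fun_pos[of "\<lambda>_. 0" M]] pool_fun_no_growth_le_1[of M]
  have lower: "r * \<alpha> - r / (real (Suc M) * (\<delta> * S))\<^sup>2 * (real (Suc M) * (S\<^sup>2 + S)) \<le> pool_fun z (\<lambda>w. N - w) N 0"
  proof (rule pool_fun_initial_bounds(1)[OF MN z1 _ S(1)])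
    fix b
    have "r * (\<alpha> - (real b - real (Suc M) * S)\<^sup>2 / (K * (\<delta> * S))\<^sup>2) \<le> r * pool_fun z (\<lambda>_. 0) M b"
      using antimono_diff_square_le[of "pool_fun z (\<lambda>_. 0) M", OF U \<beta>(3,2), of b] r
      unfolding K_def[symmetric] d \<alpha>_def by (intro mult_left_mono) auto
    also have "\<dots> \<le> pool_fun z (\<lambda>w. N - w) M b"
      unfolding r_def using s by (intro pool_fun_ge_pool_fun_no_growth) auto
    finally show "r * \<alpha> - r / (real (Suc M) * (\<delta> * S))\<^sup>2 * (real b - real (Suc M) * S)\<^sup>2 \<le> pool_fun z (\<lambda>w. N - w) M b"
      by (simp add: right_diff_distrib K_def)
  qed (use r in auto)
  have nb: "r * (\<Prod>j\<le>M. 1 / (1 + g * (1 - z j))) \<le> r * \<alpha> + r / (real (Suc M) * (\<delta> * S))\<^sup>2 * (real (Suc M) * (g\<^sup>2 + g))"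
  proof (rule nb_weight_chebyshev[OF g(1) nb_weight_pool_fun_sums[OF g(1)]])
    fix b
    have "r * pool_fun z (\<lambda>_. 0) M b \<le> r * (\<alpha> + (real b - real (Suc M) * g)\<^sup>2 / (K * (\<delta> * S))\<^sup>2)"
      using le_antimono_add_square[of "pool_fun z (\<lambda>_. 0) M", OF U \<beta>(1) g(2), of b] r
      unfolding K_def[symmetric] d \<alpha>_def by (intro mult_left_mono) auto
    then show "r * pool_fun z (\<lambda>_. 0) M b \<le> r * \<alpha> + r / (real (Suc M) * (\<delta> * S))\<^sup>2 * (real b - real (Suc M) * g)\<^sup>2"
      by (simp add: distrib_left K_def)
  qed
  have E: "r * (((1 + 2 * \<delta>)\<^sup>2 + (1 + 2 * \<delta>) / S + (1 + 1 / S)) / (real (Suc M) * \<delta>\<^sup>2))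
     \<le> 1 * (((1 + 2 * \<delta>)\<^sup>2 + (1 + 2 * \<delta>) / S + (1 + 1 / S)) / (real (Suc M) * \<delta>\<^sup>2))"
    using r S \<delta> by (intro mult_right_mono) auto
  have combine: "P - E \<le> V" if "a - t1 \<le> V" "P \<le> a + t2" "t1 + t2 = e" "e \<le> 1 * E" for V P E a e t1 t2 :: real
    using that by linarith
  show ?thesis
    using combine[OF lower nb chebyshev_error_eq[OF K S(2) \<delta>, of r "1 + 2 * \<delta>", folded g_def, unfolded K_def] E]
    unfolding g_def r_def .
qed

end

section \<open>Asymptotics\<close>

lemma drift_harm: "M \<le> N \<Longrightarrow> drift N M N = real N * (harm N - harm M) - (real N - real M)"
proof -
  assume "M \<le> N"
  \<comment> \<open>Each summand is \<open>N / j - 1\<close>. The induction needs an upper limit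
    \<open>w\<close> separate from the \<open>N\<close> inside the summand.\<close>
  have "(\<Sum>j\<in>{M<..w}. real (N - j) / real j) = real N * (harm w - harm M) - (real w - real M)" if "M \<le> w" "w \<le> N" for w
    using that
  proof (induction w rule: dec_induct)
    case base
    then show ?case by simp
  next
    case (step w)
    have "(\<Sum>j\<in>{M<..Suc w}. real (N - j) / real j) = (\<Sum>j\<in>{M<..w}. real (N - j) / real j) + real (N - Suc w) / real (Suc w)"
      using drift_Suc[of M w N] step by (simp add: drift_def)
    also have "real (N - Suc w) / real (Suc w) = real N * inverse (real (Suc w)) - 1"
      using step by (subst of_nat_diff) (auto simp: field_simps simp del: of_nat_Suc)
    finally show ?case using step by (simp add: harm_Suc algebra_simps)
  qed
  from this[of N] \<open>M \<le> N\<close> show ?thesis by (simp add: drift_def)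
qed

lemma ln_nat_at_top: "filterlim (\<lambda>N. ln (real N)) at_top sequentially"
  by (rule filterlim_compose[OF ln_at_top filterlim_real_sequentially])

lemma scale_at_top: "filterlim (\<lambda>N. real N * ln (real N)) at_top sequentially"
  by (rule filterlim_at_top_mult_at_top[OF filterlim_real_sequentially ln_nat_at_top])

lemma drift_asymptotics: "(\<lambda>N. drift N M N / (real N * ln (real N))) \<longlonglongrightarrow> 1"
proof -
  have inv: "(\<lambda>N. inverse (ln (real N))) \<longlonglongrightarrow> 0" 
    by (rule filterlim_compose[OF tendsto_inverse_0_at_top ln_nat_at_top, OF filterlim_ident, unfolded o_def]) 
  have "(\<lambda>N. (harm N - ln (real N)) * inverse (ln (real N)) + 1 - harm M * inverse (ln (real N))
      - (1 - real M * inverse (real N)) * inverse (ln (real N)))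
    \<longlonglongrightarrow> euler_mascheroni * 0 + 1 - harm M * 0 - (1 - real M * 0) * 0"
    by (intro tendsto_intros euler_mascheroni_LIMSEQ inv lim_inverse_n)
  moreover have "eventually (\<lambda>N. (harm N - ln (real N)) * inverse (ln (real N)) + 1 - harm M * inverse (ln (real N))
      - (1 - real M * inverse (real N)) * inverse (ln (real N)) = drift N M N / (real N * ln (real N))) sequentially"
    using eventually_ge_at_top[of "M + 2"]
  proof eventually_elim
    case (elim N)
    then have "ln (real N) > 0" "real N > 0" by auto
    then show ?case using elim by (simp add: drift_harm field_simps)
  qed
  ultimately show ?thesis by (simp add: tendsto_cong)
qed

lemma one_minus_exp_scaled: 
  fixes c :: real
  assumes "filterlim L at_top F"
  shows "((\<lambda>n. L n * (1 - exp (- c / L n))) \<longlongrightarrow> c) F"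
proof -
  have "((\<lambda>x. 1 - exp (- c * x)) has_real_derivative c) (at 0)"
    by (auto intro!: derivative_eq_intros)
  then have "((\<lambda>x. (1 - exp (- c * x)) / x) \<longlongrightarrow> c) (at 0)"
    by (simp add: DERIV_def)
  moreover have "filterlim (\<lambda>n. inverse (L n)) (at 0) F"
    using filterlim_compose[OF filterlim_inverse_at_right_top assms] by (rule filterlim_mono) (auto simp: at_within_le_at)
  ultimately have "((\<lambda>n. (1 - exp (- c * inverse (L n))) / inverse (L n)) \<longlongrightarrow> c) F"
    by (rule filterlim_compose)
  then show ?thesis by (simp add: field_simps)
qed

text \<open>The order of choices matters: \<open>\<delta>\<close> first, by continuity of
  \<open>P\<close> at 1, then \<open>M\<close> to make the Chebyshev error small, and
  \<open>N\<close> last. As \<open>k j\<close> vanishes beyond \<open>m\<close>, the limiting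
  product is the same for all \<open>M\<close> from \<open>m\<close> on.\<close>

lemma pool_fun_initial_limit:
  fixes k :: "nat \<Rightarrow> real"
  assumes k: "\<And>j. 0 \<le> k j" "\<And>j. m < j \<Longrightarrow> k j = 0"
  shows "(\<lambda>N. pool_fun (\<lambda>j. exp (- k j / (real N * ln (real N)))) (\<lambda>w. N - w) N 0)
    \<longlonglongrightarrow> (\<Prod>j\<le>m. 1 / (1 + k j))"
proof -
  define L where "L N = real N * ln (real N)" for N
  define z where "z N j = exp (- k j / L N)" for N j
  define P where "P t = (\<Prod>j\<le>m. 1 / (1 + t * k j))" for t
  define V where "V N = pool_fun (z N) (\<lambda>w. N - w) N 0" for N
  have L: "filterlim L at_top sequentially" using scale_at_top by (simp add: L_def[abs_def])
  have weights: "weights (z N)" for N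
  proof
    have "0 \<le> L N" by (cases "N = 0") (auto simp: L_def)
    then show "0 < z N i" "z N i \<le> 1" for i using k(1)[of i] by (auto simp: z_def)
  qed
  have z1: "z N j = 1" if "m < j" for N j using k(2)[OF that] by (simp add: z_def)
  have drift: "(\<lambda>N. drift N M N / L N) \<longlonglongrightarrow> 1" for M
    using drift_asymptotics by (simp add: L_def)
  have drift_top: "filterlim (\<lambda>N. drift N M N) at_top sequentially" for M
  proof -
    have "filterlim (\<lambda>N. drift N M N / L N * L N) at_top sequentially"
      by (rule filterlim_tendsto_pos_mult_at_top[OF drift _ L]) simp
    moreover have "eventually (\<lambda>N. drift N M N / L N * L N = drift N M N) sequentially"
      using eventually_gt_at_top[of 1] by eventually_elim (auto simp: L_def)
    ultimately show ?thesis by (simp cong: filterlim_cong)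
  qed
  have Sz: "(\<lambda>N. drift N M N * (1 - z N j)) \<longlonglongrightarrow> k j" for M j
  proof -
    have "(\<lambda>N. drift N M N / L N * (L N * (1 - z N j))) \<longlonglongrightarrow> 1 * k j"
      unfolding z_def by (intro tendsto_mult drift one_minus_exp_scaled L)
    moreover have "eventually (\<lambda>N. drift N M N / L N * (L N * (1 - z N j)) = drift N M N * (1 - z N j)) sequentially"
      using eventually_gt_at_top[of 1] by eventually_elim (auto simp: L_def)
    ultimately have "(\<lambda>N. drift N M N * (1 - z N j)) \<longlonglongrightarrow> 1 * k j" by (rule Lim_transform_eventually)
    then show ?thesis by simp
  qed
  have prod: "(\<lambda>N. \<Prod>j\<le>M. 1 / (1 + t * drift N M N * (1 - z N j))) \<longlonglongrightarrow> P t" if "m \<le> M" "0 \<le> t" for M t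
  proof -
    have "(\<lambda>N. \<Prod>j\<le>M. 1 / (1 + t * (drift N M N * (1 - z N j)))) \<longlonglongrightarrow> (\<Prod>j\<le>M. 1 / (1 + t * k j))"
      using that k(1) by (intro tendsto_intros Sz) (smt (verit) mult_nonneg_nonneg)
    also have "(\<Prod>j\<le>M. 1 / (1 + t * k j)) = P t"
      unfolding P_def using that k(2) by (intro prod.mono_neutral_right) auto
    finally show ?thesis by (simp add: mult.assoc)
  qed
  have err: "(\<lambda>N. ((t\<^sup>2 + t / drift N M N) + (1 + 1 / drift N M N)) / (real (Suc M) * \<delta>\<^sup>2))
     \<longlonglongrightarrow> ((t\<^sup>2 + 0) + (1 + 0)) / (real (Suc M) * \<delta>\<^sup>2)" if "\<delta> > 0" for t M and \<delta> :: real
    using that by (intro tendsto_intros real_tendsto_divide_at_top[OF tendsto_const drift_top]) auto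
  have err2: "(\<lambda>M. ((t\<^sup>2 + 0) + (1 + 0)) / (real (Suc M) * \<delta>\<^sup>2)) \<longlonglongrightarrow> 0" if "\<delta> > 0" for t \<delta> :: real
    using tendsto_mult_left[OF LIMSEQ_inverse_real_of_nat, of "(t\<^sup>2 + 1) / \<delta>\<^sup>2"] by (simp add: field_simps)
  have P1: "((\<lambda>\<delta>. P (1 + c * \<delta>)) \<longlongrightarrow> P 1) (at_right 0)" for c :: real
  proof -
    have "((\<lambda>\<delta>. P (1 + c * \<delta>)) \<longlongrightarrow> (\<Prod>j\<le>m. 1 / (1 + (1 + c * 0) * k j))) (at_right 0)"
      unfolding P_def using k(1) by (intro tendsto_intros) (simp add: add_nonneg_eq_0_iff)
    then show ?thesis by (simp add: P_def)
  qed
  have "V \<longlonglongrightarrow> P 1"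
  proof (rule order_tendstoI)
    fix a assume a: "a < P 1"
    have "eventually (\<lambda>\<delta>. a < P (1 + 2 * \<delta>)) (at_right 0)"
      by (rule order_tendstoD(1)[OF P1 a])
    then have "eventually (\<lambda>\<delta>. a < P (1 + 2 * \<delta>) \<and> 0 < \<delta>) (at_right 0)"
      using eventually_at_right_less[of 0] by eventually_elim auto
    then obtain \<delta> where \<delta>: "\<delta> > 0" "a < P (1 + 2 * \<delta>)"
      using eventually_happens'[OF trivial_limit_at_right_real] by blast
    have "(\<lambda>M. P (1 + 2 * \<delta>) - (((1 + 2 * \<delta>)\<^sup>2 + 0) + (1 + 0)) / (real (Suc M) * \<delta>\<^sup>2)) \<longlonglongrightarrow> P (1 + 2 * \<delta>) - 0"
      by (intro tendsto_intros err2 \<delta>)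
    from eventually_conj[OF order_tendstoD(1)[OF this, of a] eventually_ge_at_top[of m]] \<delta>
    obtain M where M: "m \<le> M" "a < P (1 + 2 * \<delta>) - (((1 + 2 * \<delta>)\<^sup>2 + 0) + (1 + 0)) / (real (Suc M) * \<delta>\<^sup>2)"
      by (auto dest: eventually_happens)
    define K where "K = (\<Sum>j\<le>m. k j)"
    have K: "k j \<le> K" for j
      using k member_le_sum[of j "{..m}" k] sum_nonneg[of "{..m}" k] by (cases "j \<le> m") (auto simp: K_def)
    \<comment> \<open>Growth is negligible: \<open>M * N\<close> factors
      \<open>exp (- K / L N)\<close> multiply to \<open>exp (- K * M / ln N)\<close>, and the
      logarithm in the scale makes this tend to 1.\<close>
    have s: "(\<lambda>N. exp (- K / L N) ^ (M * N)) \<longlonglongrightarrow> 1"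
    proof -
      have "(\<lambda>N. exp (- K * real M * inverse (ln (real N)))) \<longlonglongrightarrow> exp (- K * real M * 0)"
        by (intro tendsto_intros filterlim_compose[OF tendsto_inverse_0_at_top ln_nat_at_top] filterlim_ident)
      moreover have "eventually (\<lambda>N. exp (- K * real M * inverse (ln (real N))) = exp (- K / L N) ^ (M * N)) sequentially"
        using eventually_gt_at_top[of 1]
        by eventually_elim (simp add: L_def field_simps flip: exp_of_nat_mult)
      ultimately show ?thesis by (simp add: tendsto_cong)
    qed
    have "(\<lambda>N. exp (- K / L N) ^ (M * N) * (\<Prod>j\<le>M. 1 / (1 + (1 + 2 * \<delta>) * drift N M N * (1 - z N j)))
      - (((1 + 2 * \<delta>)\<^sup>2 + (1 + 2 * \<delta>) / drift N M N) + (1 + 1 / drift N M N)) / (real (Suc M) * \<delta>\<^sup>2))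
      \<longlonglongrightarrow> 1 * P (1 + 2 * \<delta>) - (((1 + 2 * \<delta>)\<^sup>2 + 0) + (1 + 0)) / (real (Suc M) * \<delta>\<^sup>2)"
      using \<delta> M by (intro tendsto_diff tendsto_mult s prod err) auto
    then have "eventually (\<lambda>N. a < exp (- K / L N) ^ (M * N) * (\<Prod>j\<le>M. 1 / (1 + (1 + 2 * \<delta>) * drift N M N * (1 - z N j)))
      - (((1 + 2 * \<delta>)\<^sup>2 + (1 + 2 * \<delta>) / drift N M N) + (1 + 1 / drift N M N)) / (real (Suc M) * \<delta>\<^sup>2)) sequentially"
      using M by (intro order_tendstoD) auto
    moreover have "eventually (\<lambda>N. 0 < drift N M N) sequentially"
      using drift_top by (simp add: filterlim_at_top_dense)
    ultimately show "eventually (\<lambda>N. a < V N) sequentially"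
      using eventually_ge_at_top[of "M + 2"]
    proof eventually_elim
      case (elim N)
      then have "L N > 0" by (simp add: L_def)
      then have "exp (- K / L N) \<le> z N j" for j using K[of j] by (simp add: z_def divide_right_mono)
      note elim(1)
      also have "exp (- K / L N) ^ (M * N) * (\<Prod>j\<le>M. 1 / (1 + (1 + 2 * \<delta>) * drift N M N * (1 - z N j)))
          - (((1 + 2 * \<delta>)\<^sup>2 + (1 + 2 * \<delta>) / drift N M N) + (1 + 1 / drift N M N)) / (real (Suc M) * \<delta>\<^sup>2) \<le> V N"
        unfolding V_def
      proof (rule weights.pool_fun_initial_ge[OF weights])
        show "z N w = 1" if "M < w" for w using that M(1) by (intro z1) simp
      qed (use elim \<delta> \<open>\<And>j. exp (- K / L N) \<le> z N j\<close> in auto)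
      finally show ?case .
    qed
  next
    fix a assume a: "P 1 < a"
    have "eventually (\<lambda>\<delta>. P (1 + (-2) * \<delta>) < a) (at_right 0)"
      by (rule order_tendstoD(2)[OF P1 a])
    moreover have "eventually (\<lambda>\<delta>. \<delta> \<le> 1/2) (at_right (0::real))"
      by (rule eventually_at_rightI[of 0 "1/2"]) auto
    ultimately have "eventually (\<lambda>\<delta>. P (1 - 2 * \<delta>) < a \<and> \<delta> \<le> 1/2 \<and> 0 < \<delta>) (at_right 0)"
      using eventually_at_right_less[of 0] by eventually_elim auto
    then obtain \<delta> where \<delta>: "\<delta> > 0" "\<delta> \<le> 1/2" "P (1 - 2 * \<delta>) < a"
      using eventually_happens'[OF trivial_limit_at_right_real] by blast
    have "(\<lambda>M. P (1 - 2 * \<delta>) + (((1 - 2 * \<delta>)\<^sup>2 + 0) + (1 + 0)) / (real (Suc M) * \<delta>\<^sup>2)) \<longlonglongrightarrow> P (1 - 2 * \<delta>) + 0"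
      by (intro tendsto_intros err2 \<delta>)
    from eventually_conj[OF order_tendstoD(2)[OF this, of a] eventually_ge_at_top[of m]] \<delta>
    obtain M where M: "m \<le> M" "P (1 - 2 * \<delta>) + (((1 - 2 * \<delta>)\<^sup>2 + 0) + (1 + 0)) / (real (Suc M) * \<delta>\<^sup>2) < a"
      by (auto dest: eventually_happens)
    have "(\<lambda>N. (\<Prod>j\<le>M. 1 / (1 + (1 - 2 * \<delta>) * drift N M N * (1 - z N j)))
      + (((1 - 2 * \<delta>)\<^sup>2 + (1 - 2 * \<delta>) / drift N M N) + (1 + 1 / drift N M N)) / (real (Suc M) * \<delta>\<^sup>2))
      \<longlonglongrightarrow> P (1 - 2 * \<delta>) + (((1 - 2 * \<delta>)\<^sup>2 + 0) + (1 + 0)) / (real (Suc M) * \<delta>\<^sup>2)"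
      using \<delta> M by (intro tendsto_add prod err) auto
    then have "eventually (\<lambda>N. (\<Prod>j\<le>M. 1 / (1 + (1 - 2 * \<delta>) * drift N M N * (1 - z N j)))
      + (((1 - 2 * \<delta>)\<^sup>2 + (1 - 2 * \<delta>) / drift N M N) + (1 + 1 / drift N M N)) / (real (Suc M) * \<delta>\<^sup>2) < a) sequentially"
      using M by (intro order_tendstoD) auto
    moreover have "eventually (\<lambda>N. 0 < drift N M N) sequentially"
      using drift_top by (simp add: filterlim_at_top_dense)
    ultimately show "eventually (\<lambda>N. V N < a) sequentially"
      using eventually_ge_at_top[of "M + 2"]
    proof eventually_elim
      case (elim N)
      have "V N \<le> (\<Prod>j\<le>M. 1 / (1 + (1 - 2 * \<delta>) * drift N M N * (1 - z N j)))
          + (((1 - 2 * \<delta>)\<^sup>2 + (1 - 2 * \<delta>) / drift N M N) + (1 + 1 / drift N M N)) / (real (Suc M) * \<delta>\<^sup>2)"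
        unfolding V_def
      proof (rule weights.pool_fun_initial_le[OF weights])
        show "z N w = 1" if "M < w" for w using that M(1) by (intro z1) simp
      qed (use elim \<delta> in auto)
      also note elim(1)
      finally show ?case .
    qed
  qed
  then show ?thesis unfolding V_def z_def L_def P_def by simp
qed

section \<open>The graph process\<close>

lemma num_vertices_snoc: "num_vertices (h @ [x]) = num_vertices h + (if is_vertex x then 1 else 0)"
  and num_edges_snoc: "num_edges (h @ [x]) = num_edges h + (if is_edge x then 1 else 0)"
  by (simp_all add: num_vertices_def num_edges_def)

lemma num_vertices_take_le: "num_vertices (take t h) \<le> num_vertices h"
  unfolding num_vertices_def
  by (metis append_take_drop_id filter_append le_add1 length_append)

text \<open>This is the increment from \<open>X n\<close> to \<open>X (n + 1)\<close>, and for
  \<open>n = N\<close> the final one. Counting positions makes appending an element a local change,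
  unlike the \<open>LEAST\<close> in \<open>X\<close>.\<close>

definition level_edges :: "nat \<Rightarrow> element list \<Rightarrow> nat" where
  "level_edges n h = card {t. t < length h \<and> is_edge (h ! t) \<and> num_vertices (take t h) = n}"

lemma level_edges_Nil [simp]: "level_edges n [] = 0"
  by (simp add: level_edges_def)

lemma level_edges_snoc:
  "level_edges n (h @ [x]) = level_edges n h + (if is_edge x \<and> num_vertices h = n then 1 else 0)"
proof -
  have "{t. t < length (h @ [x]) \<and> is_edge ((h @ [x]) ! t) \<and> num_vertices (take t (h @ [x])) = n}
    = {t. t < length h \<and> is_edge (h ! t) \<and> num_vertices (take t h) = n}
      \<union> (if is_edge x \<and> num_vertices h = n then {length h} else {})"
    by (auto simp: less_Suc_eq nth_append)
  then show ?thesis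
    unfolding level_edges_def by (simp add: card_insert_if)
qed

lemma num_edges_eq_sum_level_edges:
  "num_vertices h \<le> n \<Longrightarrow> num_edges h = (\<Sum>j\<le>n. level_edges j h)"
proof (induction h rule: rev_induct)
  case Nil
  then show ?case by (simp add: num_edges_def)
next
  case (snoc x h)
  then have "num_vertices h \<le> n" by (simp add: num_vertices_snoc split: if_splits)
  with snoc.IH show ?case
    by (simp add: num_edges_snoc level_edges_snoc sum.distrib sum.delta)
qed

lemma X_eq_sum_level_edges:
  "n \<le> num_vertices h \<Longrightarrow> X n h = (\<Sum>j<n. level_edges j h)"
proof (induction h rule: rev_induct)
  case Nil
  then show ?case by (simp add: X_def num_vertices_def num_edges_def)
next
  case (snoc x h)
  show ?case
  proof (cases "n \<le> num_vertices h")
    case True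
    define s where "s = (LEAST t. n \<le> num_vertices (take t h))"
    have s: "n \<le> num_vertices (take s h)" "s \<le> length h"
      unfolding s_def by (rule LeastI[of _ "length h"], use True in simp) (rule Least_le, use True in simp)
    have "(LEAST t. n \<le> num_vertices (take t (h @ [x]))) = s"
    proof (rule Least_equality)
      show "n \<le> num_vertices (take s (h @ [x]))" using s by simp
      fix t assume t: "n \<le> num_vertices (take t (h @ [x]))"
      show "s \<le> t"
      proof (cases "t \<le> length h")
        case True
        then show ?thesis using t unfolding s_def by (intro Least_le) simp
      qed (use s in simp)
    qed
    then have "X n (h @ [x]) = X n h" using s by (simp add: X_def s_def)
    moreover have "level_edges j (h @ [x]) = level_edges j h" if "j < n" for j
      using that True by (simp add: level_edges_snoc)
    ultimately show ?thesis using snoc.IH[OF True] by simp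
  next
    case False
    with snoc.prems have x: "is_vertex x" "\<not> is_edge x" and n: "n = Suc (num_vertices h)"
      by (auto simp: num_vertices_snoc split: if_splits)
    \<comment> \<open>Here \<open>x\<close> is itself the \<open>n\<close>-th vertex, so no shorter
      prefix contains \<open>n\<close> vertices.\<close>
    have "(LEAST t. n \<le> num_vertices (take t (h @ [x]))) = Suc (length h)"
    proof (rule Least_equality)
      show "n \<le> num_vertices (take (Suc (length h)) (h @ [x]))" using snoc.prems by simp
      fix t assume t: "n \<le> num_vertices (take t (h @ [x]))"
      show "Suc (length h) \<le> t"
        using t n num_vertices_take_le[of t h] by (rule_tac ccontr) simp
    qed
    then have "X n (h @ [x]) = num_edges h" using x by (simp add: X_def num_edges_snoc)
    also have "\<dots> = (\<Sum>j<n. level_edges j h)"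
      using num_edges_eq_sum_level_edges[of h "num_vertices h"] n by (simp add: lessThan_Suc_atMost)
    finally show ?thesis using x by (simp add: level_edges_snoc)
  qed
qed

text \<open>The index \<open>N - n\<close> converts occupied vertices into virtual ones, by which
  \<open>pool_fun\<close> indexes its weights.\<close>

definition history_weight :: "(nat \<Rightarrow> real) \<Rightarrow> nat \<Rightarrow> element list \<Rightarrow> real" where
  "history_weight z N h = (\<Prod>n\<le>N. z (N - n) ^ level_edges n h)"

lemma history_weight_snoc:
  assumes "num_vertices h \<le> N"
  shows "history_weight z N (h @ [x]) = history_weight z N h * (if is_edge x then z (N - num_vertices h) else 1)"
proof (cases "is_edge x")
  case True
  have "history_weight z N (h @ [x]) = (\<Prod>n\<le>N. z (N - n) ^ level_edges n h * (if num_vertices h = n then z (N - n) else 1))"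
    unfolding history_weight_def by (intro prod.cong) (auto simp: level_edges_snoc True)
  then show ?thesis using True assms
    by (simp add: prod.distrib history_weight_def prod.delta)
qed (simp add: history_weight_def level_edges_snoc)

section \<open>Pool sizes and the martingale of weights\<close>

lemma finite_set_pmf_history: "finite (set_pmf (history N t))"
  by (induction t) (auto simp: finite_pool set_pmf_of_set)

text \<open>\<open>history_invariant\<close> bounds edge labels only by \<open>N\<close>; the exact
  number of virtual edges requires the bound by the current number of vertices.\<close>

lemma history_edges:
  assumes "h \<in> set_pmf (history N t)"
  shows "set h \<subseteq> Vertex ` {1..N} \<union> {Edge i j |i j. 1 \<le> i \<and> i < j \<and> j \<le> num_vertices h}"
  using assms
proof (induction t arbitrary: h)
  case (Suc t)
  let ?E = "\<lambda>h. {Edge i j |i j. 1 \<le> i \<and> i < j \<and> j \<le> num_vertices h}"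
  obtain g where g: "g \<in> set_pmf (history N t)"
    and h: "h \<in> set_pmf (if pool N g = {} then return_pmf g
       else map_pmf (\<lambda>x. g @ [x]) (pmf_of_set (pool N g)))"
    using Suc.prems by auto
  note IH = Suc.IH[OF g]
  show ?case
  proof (cases "pool N g = {}")
    case False
    then obtain x where x: "x \<in> pool N g" "h = g @ [x]"
      using h finite_pool by auto
    have "num_vertices g \<le> num_vertices h" using x by (simp add: num_vertices_snoc)
    then have "?E g \<subseteq> ?E h" by (blast intro: le_trans)
    moreover have "x \<in> Vertex ` {1..N} \<union> ?E g"
      using x(1) unfolding pool_def by (rule DiffD1)
    ultimately have "insert x (set g) \<subseteq> Vertex ` {1..N} \<union> ?E h"
      using IH by (meson Un_mono insert_subset order_refl subset_trans subsetD)
    then show ?thesis using x by simp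
  qed (use h IH in simp)
qed simp

lemma card_pool:
  assumes "h \<in> set_pmf (history N t)"
  shows "num_vertices h \<le> N" "num_edges h \<le> num_vertices h choose 2"
    "card {x \<in> pool N h. is_vertex x} = N - num_vertices h"
    "card {x \<in> pool N h. is_edge x} = (num_vertices h choose 2) - num_edges h"
proof -
  let ?V = "Vertex ` {1..N}" and ?E = "{Edge i j |i j. 1 \<le> i \<and> i < j \<and> j \<le> num_vertices h}"
  note inv = history_invariant[OF assms] and edges = history_edges[OF assms]
  show "num_vertices h \<le> N" using inv by simp
  have nv: "num_vertices h = card (set (filter is_vertex h))" and ne: "num_edges h = card (set (filter is_edge h))"
    unfolding num_vertices_def num_edges_def using inv by (metis distinct_card distinct_filter)+
  have sub: "set (filter is_vertex h) \<subseteq> ?V" "set (filter is_edge h) \<subseteq> ?E"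
    using edges by auto
  show "num_edges h \<le> num_vertices h choose 2"
    unfolding ne card_edges[symmetric] using sub finite_edges by (intro card_mono)
  have "{x \<in> pool N h. is_vertex x} = ?V - set (filter is_vertex h)" by (auto simp: pool_def)
  then show "card {x \<in> pool N h. is_vertex x} = N - num_vertices h"
    using sub by (simp add: card_Diff_subset nv card_image inj_on_def)
  have "{x \<in> pool N h. is_edge x} = ?E - set (filter is_edge h)" by (auto simp: pool_def)
  then show "card {x \<in> pool N h. is_edge x} = (num_vertices h choose 2) - num_edges h"
    using card_Diff_subset[OF _ sub(2)] by (simp only: ne card_edges finite_set simp_thms)
qed

text \<open>The conditional expectation of the weight still to be collected. Its product with
  \<open>history_weight\<close> is the Doob martingale of the final weight.\<close>

definition remaining :: "(nat \<Rightarrow> real) \<Rightarrow> nat \<Rightarrow> element list \<Rightarrow> real" where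
  "remaining z N h = pool_fun z (\<lambda>w. N - w) (N - num_vertices h) ((num_vertices h choose 2) - num_edges h)"

lemma weighted_remaining_step:
  assumes h: "h \<in> set_pmf (history N t)" and ne: "pool N h \<noteq> {}"
  shows "(\<Sum>x\<in>pool N h. history_weight z N (h @ [x]) * remaining z N (h @ [x]))
    = real (card (pool N h)) * (history_weight z N h * remaining z N h)"
proof -
  define v where "v = num_vertices h"
  define w where "w = N - v"
  define b where "b = (v choose 2) - num_edges h"
  define W where "W = history_weight z N h"
  let ?V = "pool_fun z (\<lambda>w. N - w)"
  let ?f = "\<lambda>x. history_weight z N (h @ [x]) * remaining z N (h @ [x])"
  note card = card_pool[OF h, folded v_def, folded w_def b_def]
  have split: "pool N h = {x \<in> pool N h. is_vertex x} \<union> {x \<in> pool N h. is_edge x}"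
    using element.exhaust_disc by blast
  have disj: "{x \<in> pool N h. is_vertex x} \<inter> {x \<in> pool N h. is_edge x} = {}"
    by (auto elim: element.distinct_disc)
  have fin: "finite {x \<in> pool N h. is_vertex x}" "finite {x \<in> pool N h. is_edge x}"
    using finite_pool by auto
  have cp: "card (pool N h) = b + w"
    by (subst split, subst card_Un_disjoint[OF fin disj]) (simp add: card)
  have V: "?f x = W * ?V (w - 1) (b + (N - w))" if "x \<in> {x \<in> pool N h. is_vertex x}" for x
  proof -
    have "\<not> is_edge x" using that by (cases x) auto
    \<comment> \<open>The new vertex brings \<open>v = N - w\<close> edges, the growth used in
      \<open>pool_fun\<close>; \<open>card(2)\<close> keeps the truncated subtraction exact.\<close>
    moreover have "(Suc v choose 2) - num_edges h = b + v"
      using card(2) by (simp add: b_def numeral_2_eq_2)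
    ultimately show ?thesis
      using that card(1) by (simp add: history_weight_snoc v_def[symmetric] W_def[symmetric] remaining_def num_vertices_snoc num_edges_snoc w_def)
  qed
  have E: "?f x = W * (z w * ?V w (b - 1))" if "x \<in> {x \<in> pool N h. is_edge x}" for x
  proof -
    have "\<not> is_vertex x" "is_edge x" using that by (cases x; simp)+
    then show ?thesis
      using card(1) by (simp add: history_weight_snoc v_def[symmetric] W_def[symmetric] remaining_def num_vertices_snoc num_edges_snoc w_def b_def)
  qed
  have "(\<Sum>x\<in>pool N h. ?f x) = real w * (W * ?V (w - 1) (b + (N - w))) + real b * (W * (z w * ?V w (b - 1)))"
    by (subst split, subst sum.union_disjoint[OF fin disj]) (simp only: sum.cong[OF refl V] sum.cong[OF refl E] sum_constant card)
  also have "\<dots> = W * (real b * z w * ?V w (b - 1) + real w * ?V (w - 1) (b + (N - w)))"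
    by (simp add: algebra_simps)
  also have "\<dots> = W * (real (b + w) * ?V w b)"
    by (subst pool_fun_rec) simp
  finally show ?thesis
    unfolding cp by (simp add: W_def remaining_def v_def[symmetric] w_def[symmetric] b_def[symmetric])
qed

text \<open>A martingale has constant expectation; steps with an empty pool leave the history
  unchanged.\<close>

lemma expectation_weighted_remaining:
  "measure_pmf.expectation (history N t) (\<lambda>h. history_weight z N h * remaining z N h) = pool_fun z (\<lambda>w. N - w) N 0"
proof (induction t)
  case 0
  then show ?case by (simp add: history_weight_def remaining_def num_vertices_def num_edges_def binomial_eq_0)
next
  case (Suc t)
  let ?f = "\<lambda>h. history_weight z N h * remaining z N h"
  let ?K = "\<lambda>h. if pool N h = {} then return_pmf h else map_pmf (\<lambda>x. h @ [x]) (pmf_of_set (pool N h))"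
  have step: "measure_pmf.expectation (?K h) ?f = ?f h" if h: "h \<in> set_pmf (history N t)" for h
  proof (cases "pool N h = {}")
    case False
    then have "card (pool N h) > 0" using finite_pool by (simp add: card_gt_0_iff)
    with False show ?thesis
      using weighted_remaining_step[OF h False, of z] finite_pool[of N h] by (simp add: integral_pmf_of_set)
  qed simp
  have "measure_pmf.expectation (history N (Suc t)) ?f
    = (\<Sum>h\<in>set_pmf (history N t). pmf (history N t) h *\<^sub>R measure_pmf.expectation (?K h) ?f)"
    unfolding history.simps
    by (rule pmf_expectation_bind) (use finite_set_pmf_history finite_pool in auto)
  also have "\<dots> = (\<Sum>h\<in>set_pmf (history N t). pmf (history N t) h *\<^sub>R ?f h)"
    using step by (intro sum.cong) auto
  also have "\<dots> = measure_pmf.expectation (history N t) ?f"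
    by (rule integral_measure_pmf[symmetric]) (use finite_set_pmf_history in auto)
  finally show ?case using Suc by simp
qed

lemma growing_graph_final:
  assumes "h \<in> set_pmf (growing_graph N)"
  shows "num_vertices h = N" "num_edges h = N choose 2"
proof -
  have h: "h \<in> set_pmf (history N (N + (N choose 2)))" using assms by (simp add: growing_graph_def)
  have p: "pool N h = {}" by (rule pool_growing_graph[OF assms])
  show v: "num_vertices h = N" using card_pool(1,3)[OF h] p by simp
  show "num_edges h = N choose 2" using card_pool(2,4)[OF h] p v by simp
qed

lemma expectation_history_weight:
  "measure_pmf.expectation (growing_graph N) (history_weight z N) = pool_fun z (\<lambda>w. N - w) N 0"
proof -
  have "measure_pmf.expectation (growing_graph N) (history_weight z N)
    = measure_pmf.expectation (growing_graph N) (\<lambda>h. history_weight z N h * remaining z N h)"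
    by (intro integral_cong_AE) (auto simp: AE_measure_pmf_iff remaining_def growing_graph_final)
  then show ?thesis using expectation_weighted_remaining[of N _ z] by (simp add: growing_graph_def)
qed

lemma \<Delta>X_eq_level_edges:
  assumes "h \<in> set_pmf (growing_graph N)" "n \<le> N"
  shows "\<Delta>X N (Suc n) h = real (level_edges n h)"
proof -
  note fin = growing_graph_final[OF assms(1)]
  show ?thesis
  proof (cases "n < N")
    case True
    then show ?thesis using fin by (simp add: \<Delta>X_def X_eq_sum_level_edges)
  next
    case False
    then have "n = N" using assms by simp
    moreover have "num_edges h = (\<Sum>j<N. level_edges j h) + level_edges N h"
      using num_edges_eq_sum_level_edges[of h N] fin by (simp flip: lessThan_Suc_atMost)
    ultimately show ?thesis using fin by (simp add: \<Delta>X_def X_eq_sum_level_edges)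
  qed
qed

text \<open>Indices beyond \<open>N + 1\<close> occur when \<open>N < m\<close>, because
  \<open>N - m\<close> is truncated. There \<open>\<Delta>X\<close> repeats the final increment, so
  nonnegativity holds for every \<open>N\<close>.\<close>

lemma \<Delta>X_nonneg:
  assumes "h \<in> set_pmf (growing_graph N)" "0 < n"
  shows "0 \<le> \<Delta>X N n h"
proof (cases "n \<le> N")
  case True
  then show ?thesis using \<Delta>X_eq_level_edges[OF assms(1), of "n - 1"] assms(2) by simp
next
  case False
  then have "\<Delta>X N n h = \<Delta>X N (Suc N) h" by (simp add: \<Delta>X_def)
  then show ?thesis using \<Delta>X_eq_level_edges[OF assms(1), of N] by simp
qed

text \<open>Component \<open>i\<close> counts the edges selected while \<open>N - m + i\<close>
  vertices are occupied, that is, while \<open>m - i\<close> are virtual; hence the reversal from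
  \<open>i\<close> to \<open>m - w\<close>.\<close>

lemma prod_exp_\<Delta>X:
  fixes k :: "nat \<Rightarrow> real"
  assumes h: "h \<in> set_pmf (growing_graph N)" and "m \<le> N"
  shows "(\<Prod>i\<le>m. exp (- (k i * (\<Delta>X N (N - m + 1 + i) h / L))))
    = history_weight (\<lambda>w. exp (- (if w \<le> m then k (m - w) else 0) / L)) N h"
proof -
  have "history_weight (\<lambda>w. exp (- (if w \<le> m then k (m - w) else 0) / L)) N h
    = (\<Prod>n\<in>{N - m..N}. exp (- k (m - (N - n)) / L) ^ level_edges n h)"
    unfolding history_weight_def by (rule prod.mono_neutral_cong_right) auto
  also have "\<dots> = (\<Prod>i\<le>m. exp (- k i / L) ^ level_edges (N - m + i) h)"
    by (rule prod.reindex_bij_witness[of _ "\<lambda>i. N - m + i" "\<lambda>n. n - (N - m)"]) (use \<open>m \<le> N\<close> in \<open>auto simp: add.commute\<close>)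
  also have "\<dots> = (\<Prod>i\<le>m. exp (- (k i * (\<Delta>X N (N - m + 1 + i) h / L))))"
  proof (rule prod.cong)
    fix i assume "i \<in> {..m}"
    then have "\<Delta>X N (N - m + 1 + i) h = real (level_edges (N - m + i) h)"
      using \<Delta>X_eq_level_edges[OF h, of "N - m + i"] \<open>m \<le> N\<close> by simp
    then show "exp (- k i / L) ^ level_edges (N - m + i) h = exp (- (k i * (\<Delta>X N (N - m + 1 + i) h / L)))"
      by (simp add: mult_ac flip: exp_of_nat_mult)
  qed simp
  finally show ?thesis ..
qed

section \<open>Weak convergence from Laplace transforms\<close>

text \<open>Polynomials in the coordinates from \<open>I\<close>. The scalar sits in the generators,
  so closure under sums is enough.\<close>

inductive_set monomial_span :: "nat set \<Rightarrow> ((nat \<Rightarrow> real) \<Rightarrow> real) set" for I where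
  monomial: "(\<lambda>y. c * (\<Prod>i\<in>I. y i ^ k i)) \<in> monomial_span I"
| add: "p \<in> monomial_span I \<Longrightarrow> q \<in> monomial_span I \<Longrightarrow> (\<lambda>y. p y + q y) \<in> monomial_span I"

lemma monomial_span_mult:
  assumes "p \<in> monomial_span I" "q \<in> monomial_span I"
  shows "(\<lambda>y. p y * q y) \<in> monomial_span I"
  using assms
proof (induction p)
  case (monomial c k)
  from monomial show ?case
  proof (induction q)
    case (monomial d l)
    have "(\<lambda>y. c * (\<Prod>i\<in>I. y i ^ k i) * (d * (\<Prod>i\<in>I. y i ^ l i)))
      = (\<lambda>y. (c * d) * (\<Prod>i\<in>I. y i ^ (k i + l i)))"
      by (simp add: power_add prod.distrib mult_ac)
    then show ?case by (simp only: monomial_span.monomial)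
  next
    case (add p q)
    then show ?case by (simp only: distrib_left monomial_span.add)
  qed
next
  case (add p p')
  then show ?case by (simp only: distrib_right monomial_span.add)
qed

lemma continuous_on_monomial_span:
  assumes "p \<in> monomial_span I"
  shows "continuous_on S p"
proof -
  have "continuous_on UNIV p" using assms
    by induction (auto intro!: continuous_intros continuous_on_product_coordinates)
  then show ?thesis by (rule continuous_on_subset) simp
qed

text \<open>The cube lies in the full function space, whose type class topology serves
  Stone-Weierstrass. Coordinates outside \<open>I\<close> are frozen at 0, so those in
  \<open>I\<close> separate points.\<close>

definition unit_cube :: "nat set \<Rightarrow> (nat \<Rightarrow> real) set" where
  "unit_cube I = (\<Pi>\<^sub>E i\<in>UNIV. if i \<in> I then {0..1} else {0})"

lemma compact_unit_cube: "compact (unit_cube I)"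
proof -
  have "compactin (product_topology (\<lambda>_. euclideanreal) UNIV) (unit_cube I)"
    unfolding unit_cube_def by (subst compactin_PiE) (auto simp: compactin_euclidean_iff)
  then show ?thesis by (simp add: euclidean_product_topology compactin_euclidean_iff)
qed

lemma monomial_span_dense:
  fixes g :: "(nat \<Rightarrow> real) \<Rightarrow> real"
  assumes I: "finite I" and g: "continuous_on (unit_cube I) g" and e: "0 < e"
  obtains p where "p \<in> monomial_span I" "\<And>y. y \<in> unit_cube I \<Longrightarrow> \<bar>g y - p y\<bar> < e"
proof -
  have const: "(\<lambda>_. c) \<in> monomial_span I" for c
    using monomial_span.monomial[of c "\<lambda>_. 0" I] by simp
  have separable: "\<exists>f\<in>monomial_span I. f x \<noteq> f y"
    if xy: "x \<in> unit_cube I" "y \<in> unit_cube I" "x \<noteq> y" for x y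
  proof -
    from xy(3) obtain j where j: "x j \<noteq> y j" by auto
    have "j \<in> I"
    proof (rule ccontr)
      assume "j \<notin> I"
      then have "x j = 0" "y j = 0"
        using PiE_mem[OF xy(1)[unfolded unit_cube_def], of j] PiE_mem[OF xy(2)[unfolded unit_cube_def], of j]
        by simp_all
      with j show False by simp
    qed
    have "(\<Prod>i\<in>I. z i ^ (if i = j then 1 else 0)) = z j" for z :: "nat \<Rightarrow> real"
    proof -
      have "(\<Prod>i\<in>I. z i ^ (if i = j then 1 else 0)) = (\<Prod>i\<in>I. if i = j then z i else 1)"
        by (intro prod.cong) auto
      then show ?thesis using I \<open>j \<in> I\<close> by simp
    qed
    then have "(\<lambda>z. z j) \<in> monomial_span I"
      using monomial_span.monomial[of 1 "\<lambda>i. if i = j then 1 else 0" I] by simp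
    with j show ?thesis
      using bexI[where P = "\<lambda>f. f x \<noteq> f y" and x = "\<lambda>z. z j"] by simp
  qed
  interpret function_ring_on "monomial_span I" "unit_cube I"
    by (rule function_ring_on.intro)
       (rule compact_unit_cube, erule continuous_on_monomial_span, erule (1) monomial_span.add,
        erule (1) monomial_span_mult, rule const, erule (2) separable)
  from Stone_Weierstrass_basic[OF g e] obtain p where "p \<in> monomial_span I" "\<forall>y\<in>unit_cube I. \<bar>g y - p y\<bar> < e"
    by (elim bexE)
  then show thesis by (intro that[of p]) simp_all
qed

section \<open>Laws on the nonnegative orthant, seen as laws on the cube\<close>

locale nonneg_law = prob_space M for M :: "(nat \<Rightarrow> real) measure" and I :: "nat set" +
  assumes finite_index: "finite I" and sets_eq: "sets M = sets (PiM I (\<lambda>_. borel))"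
    and nonneg: "AE x in M. \<forall>i\<in>I. 0 \<le> x i"

definition exp_neg :: "nat set \<Rightarrow> (nat \<Rightarrow> real) \<Rightarrow> nat \<Rightarrow> real" where
  "exp_neg I x i = (if i \<in> I then exp (- x i) else 0)"

lemma exp_neg_in_unit_cube: "(\<And>i. i \<in> I \<Longrightarrow> 0 \<le> x i) \<Longrightarrow> exp_neg I x \<in> unit_cube I"
  by (auto simp: unit_cube_def exp_neg_def)

context nonneg_law
begin

lemma AE_exp_neg: "AE x in M. exp_neg I x \<in> unit_cube I"
  using nonneg by eventually_elim (auto intro: exp_neg_in_unit_cube)

lemma measurable_exp_neg:
  fixes g :: "(nat \<Rightarrow> real) \<Rightarrow> real"
  assumes g: "continuous_on UNIV g"
  shows "(\<lambda>x. g (exp_neg I x)) \<in> borel_measurable M"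
proof -
  have "g \<in> borel_measurable (PiM UNIV (\<lambda>_. borel))"
    by (subst measurable_cong_sets[OF sets_PiM_equal_borel refl]) (rule borel_measurable_continuous_onI[OF g])
  moreover have "exp_neg I \<in> M \<rightarrow>\<^sub>M PiM UNIV (\<lambda>_. borel :: real measure)"
  proof (subst measurable_cong_sets[OF sets_eq refl], rule measurable_PiM_single')
    fix i
    show "(\<lambda>x. exp_neg I x i) \<in> borel_measurable (PiM I (\<lambda>_. borel))"
      unfolding exp_neg_def by (cases "i \<in> I") auto
  qed auto
  ultimately show ?thesis by (rule measurable_compose[rotated])
qed

lemma integrable_exp_neg:
  fixes g :: "(nat \<Rightarrow> real) \<Rightarrow> real"
  assumes g: "continuous_on UNIV g"
  shows "integrable M (\<lambda>x. g (exp_neg I x))"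
proof -
  have "compact (g ` unit_cube I)"
    using g compact_unit_cube by (intro compact_continuous_image) (auto intro: continuous_on_subset)
  from compact_imp_bounded[OF this] obtain B where "\<forall>y\<in>g ` unit_cube I. norm y \<le> B"
    by (auto simp only: bounded_iff)
  then have B: "norm (g y) \<le> B" if "y \<in> unit_cube I" for y
    using that by simp
  have "AE x in M. norm (g (exp_neg I x)) \<le> B"
    using AE_exp_neg by eventually_elim (rule B)
  then show ?thesis
    by (rule integrable_const_bound) (rule measurable_exp_neg[OF g])
qed

lemma integral_exp_neg_close:
  fixes g :: "(nat \<Rightarrow> real) \<Rightarrow> real"
  assumes g: "continuous_on UNIV g" and p: "p \<in> monomial_span I"
    and close: "\<And>y. y \<in> unit_cube I \<Longrightarrow> \<bar>g y - p y\<bar> < e"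
  shows "\<bar>(\<integral>x. g (exp_neg I x) \<partial>M) - (\<integral>x. p (exp_neg I x) \<partial>M)\<bar> \<le> e"
proof -
  have p': "continuous_on UNIV p" using p by (rule continuous_on_monomial_span)
  have "(\<integral>x. g (exp_neg I x) \<partial>M) - (\<integral>x. p (exp_neg I x) \<partial>M) = (\<integral>x. g (exp_neg I x) - p (exp_neg I x) \<partial>M)"
    by (rule Bochner_Integration.integral_diff[symmetric]) (rule integrable_exp_neg g p')+
  moreover have "\<bar>\<integral>x. g (exp_neg I x) - p (exp_neg I x) \<partial>M\<bar> \<le> (\<integral>x. \<bar>g (exp_neg I x) - p (exp_neg I x)\<bar> \<partial>M)"
    by (rule integral_abs_bound)
  moreover have "(\<integral>x. \<bar>g (exp_neg I x) - p (exp_neg I x)\<bar> \<partial>M) \<le> (\<integral>x. e \<partial>M)"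
  proof (rule integral_mono_AE)
    show "AE x in M. \<bar>g (exp_neg I x) - p (exp_neg I x)\<bar> \<le> e"
      using AE_exp_neg by eventually_elim (use close in \<open>auto intro: less_imp_le\<close>)
  qed (use integrable_exp_neg[OF g] integrable_exp_neg[OF p'] in auto)
  moreover have "(\<integral>x. e \<partial>M) = e" by (simp add: prob_space)
  ultimately show ?thesis by linarith
qed

text \<open>Tightness of one law: \<open>exp (- x i)\<close> is positive at every finite
  \<open>x i\<close>, so each power tends to 0, with the dominating constant
  \<open>card I\<close>.\<close>

lemma tail_integral_tendsto_0:
  "(\<lambda>k. \<integral>x. (\<Sum>i\<in>I. (1 - exp_neg I x i) ^ k) \<partial>M) \<longlonglongrightarrow> 0"
proof -
  have "(\<lambda>k. \<integral>x. (\<Sum>i\<in>I. (1 - exp_neg I x i) ^ k) \<partial>M) \<longlonglongrightarrow> (\<integral>x. 0 \<partial>M)"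
  proof (rule integral_dominated_convergence[where w = "\<lambda>_. real (card I)"])
    show "(\<lambda>x. \<Sum>i\<in>I. (1 - exp_neg I x i) ^ k) \<in> borel_measurable M" for k
      by (rule measurable_exp_neg[of "\<lambda>y. \<Sum>i\<in>I. (1 - y i) ^ k"])
         (intro continuous_intros continuous_on_product_coordinates)
    show "AE x in M. (\<lambda>k. \<Sum>i\<in>I. (1 - exp_neg I x i) ^ k) \<longlonglongrightarrow> 0"
      using nonneg
    proof eventually_elim
      case (elim x)
      have "(\<lambda>k. \<Sum>i\<in>I. (1 - exp_neg I x i) ^ k) \<longlonglongrightarrow> (\<Sum>i\<in>I. 0)"
        by (intro tendsto_sum LIMSEQ_power_zero) (use elim in \<open>auto simp: exp_neg_def abs_if\<close>)
      then show ?case by simp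
    qed
    show "AE x in M. norm (\<Sum>i\<in>I. (1 - exp_neg I x i) ^ k) \<le> real (card I)" for k
      using nonneg
    proof eventually_elim
      case (elim x)
      have "norm (\<Sum>i\<in>I. (1 - exp_neg I x i) ^ k) \<le> (\<Sum>i\<in>I. norm ((1 - exp_neg I x i) ^ k))"
        by (rule norm_sum)
      also have "\<dots> \<le> (\<Sum>i\<in>I. 1)"
        by (intro sum_mono) (use elim in \<open>auto simp: exp_neg_def power_abs abs_if intro!: power_le_one\<close>)
      finally show ?case by simp
    qed
  qed auto
  then show ?thesis by simp
qed

end

text \<open>\<open>- ln\<close> inverts \<open>exp_neg\<close> on \<open>I\<close>; bounding its
  argument below by \<open>e\<close> keeps the composite continuous on the whole space.\<close>

lemma continuous_truncated_ln:
  fixes f :: "(nat \<Rightarrow> real) \<Rightarrow> real"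
  assumes f: "continuous_map (product_topology (\<lambda>_. euclideanreal) I) euclideanreal f" and e: "0 < e"
  shows "continuous_on UNIV (\<lambda>y. f (\<lambda>i\<in>I. - ln (max (y i) e)))"
proof -
  have "continuous_map (euclidean :: (nat \<Rightarrow> real) topology) (product_topology (\<lambda>_. euclideanreal) I)
      (\<lambda>y. \<lambda>i\<in>I. - ln (max (y i) e))"
  proof (subst continuous_map_componentwise, intro conjI ballI)
    fix i assume "i \<in> I"
    have "continuous_on UNIV (\<lambda>y :: nat \<Rightarrow> real. - ln (max (y i) e))"
      by (intro continuous_intros continuous_on_product_coordinates) (use e in auto)
    then show "continuous_map (euclidean :: (nat \<Rightarrow> real) topology) euclideanreal (\<lambda>y. (\<lambda>i\<in>I. - ln (max (y i) e)) i)"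
      using \<open>i \<in> I\<close> by (simp only: restrict_apply' continuous_map_iff_continuous2)
  qed auto
  from continuous_map_compose[OF this f] show ?thesis by (simp add: o_def)
qed

text \<open>
  \<open>f\<close> need not extend continuously in the variables \<open>exp (- x i)\<close> to the faces \<open>y i = 0\<close> of the cube.
  Truncating at \<open>1 / (2 * k)\<close> changes it only where some \<open>(1 - exp (- x i)) ^ k\<close> is at least
  \<open>1 / 2\<close>, by Bernoulli's inequality, so the error is again a continuous function on the cube.
\<close>

lemma truncated_ln_error:
  assumes x: "x \<in> extensional I" "\<And>i. i \<in> I \<Longrightarrow> 0 \<le> x i" and f: "\<And>y. y \<in> extensional I \<Longrightarrow> \<bar>f y\<bar> \<le> B"
    and k: "0 < k" and I: "finite I"
  shows "\<bar>f x - f (\<lambda>i\<in>I. - ln (max (exp_neg I x i) (1 / (2 * real k))))\<bar> \<le> 4 * B * (\<Sum>i\<in>I. (1 - exp_neg I x i) ^ k)"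
proof -
  define e where "e = 1 / (2 * real k)"
  have B: "0 \<le> B" using f[OF x(1)] by linarith
  have s: "0 \<le> (1 - exp_neg I x i) ^ k" if "i \<in> I" for i
    using x(2)[OF that] that by (simp add: exp_neg_def)
  show ?thesis
  proof (cases "\<forall>i\<in>I. e \<le> exp_neg I x i")
    case True
    then have "(\<lambda>i\<in>I. - ln (max (exp_neg I x i) e)) = (\<lambda>i\<in>I. - ln (exp_neg I x i))"
      by (intro restrict_ext) (simp add: max_absorb1)
    also have "\<dots> = x"
      using x(1) by (auto simp: fun_eq_iff extensional_def exp_neg_def)
    finally have "(\<lambda>i\<in>I. - ln (max (exp_neg I x i) e)) = x" .
    then show ?thesis using B s unfolding e_def by (simp add: sum_nonneg)
  next
    case False
    then obtain j where j: "j \<in> I" "exp_neg I x j < e" by auto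
    have "1 + real k * (- e) \<le> (1 + (- e)) ^ k"
      using k by (intro Bernoulli_inequality) (simp add: e_def field_simps)
    moreover have "real k * e = 1/2" using k by (simp add: e_def)
    ultimately have "1/2 \<le> (1 - e) ^ k" by simp
    also have "\<dots> \<le> (1 - exp_neg I x j) ^ k"
      using j k by (intro power_mono) (auto simp: e_def field_simps)
    also have "\<dots> \<le> (\<Sum>i\<in>I. (1 - exp_neg I x i) ^ k)"
      by (rule member_le_sum[OF j(1)]) (use s I in auto)
    finally have "4 * B * (1/2) \<le> 4 * B * (\<Sum>i\<in>I. (1 - exp_neg I x i) ^ k)"
      using B by (intro mult_left_mono) auto
    moreover have "\<bar>f x\<bar> \<le> B" "\<bar>f (\<lambda>i\<in>I. - ln (max (exp_neg I x i) e))\<bar> \<le> B"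
      using x(1) f by auto
    ultimately show ?thesis unfolding e_def by linarith
  qed
qed

context nonneg_law
begin

lemma truncated_ln_integral_error:
  assumes f: "continuous_map (product_topology (\<lambda>_. euclideanreal) I) euclideanreal f"
    and B: "\<And>y. y \<in> extensional I \<Longrightarrow> \<bar>f y\<bar> \<le> B" and k: "0 < k"
  shows "\<bar>(\<integral>x. f x \<partial>M) - (\<integral>x. f (\<lambda>i\<in>I. - ln (max (exp_neg I x i) (1 / (2 * real k)))) \<partial>M)\<bar>
    \<le> 4 * B * (\<integral>x. (\<Sum>i\<in>I. (1 - exp_neg I x i) ^ k) \<partial>M)"
proof -
  let ?g = "\<lambda>x. f (\<lambda>i\<in>I. - ln (max (exp_neg I x i) (1 / (2 * real k))))"
  let ?h = "\<lambda>x. 4 * B * (\<Sum>i\<in>I. (1 - exp_neg I x i) ^ k)"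
  have space: "space M \<subseteq> extensional I"
    using sets_eq_imp_space_eq[OF sets_eq] by (auto simp: space_PiM PiE_def)
  have fm: "f \<in> borel_measurable M"
    using borel_measurable_PiM_continuous_map[OF f] by (subst measurable_cong_sets[OF sets_eq refl])
  have "AE x in M. norm (f x) \<le> B" using B space by (intro AE_I2) auto
  then have fi: "integrable M f" by (rule integrable_const_bound[OF _ fm])
  have gi: "integrable M ?g"
    by (rule integrable_exp_neg[OF continuous_truncated_ln[OF f]]) (use k in simp)
  have hi: "integrable M ?h"
    by (rule integrable_exp_neg[of "\<lambda>y. 4 * B * (\<Sum>i\<in>I. (1 - y i) ^ k)"])
       (intro continuous_intros continuous_on_product_coordinates)
  have "(\<integral>x. f x \<partial>M) - (\<integral>x. ?g x \<partial>M) = (\<integral>x. f x - ?g x \<partial>M)"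
    by (rule Bochner_Integration.integral_diff[symmetric]) fact+
  moreover have "\<bar>\<integral>x. f x - ?g x \<partial>M\<bar> \<le> (\<integral>x. \<bar>f x - ?g x\<bar> \<partial>M)"
    by (rule integral_abs_bound)
  moreover have "(\<integral>x. \<bar>f x - ?g x\<bar> \<partial>M) \<le> (\<integral>x. ?h x \<partial>M)"
  proof (rule integral_mono_AE)
    show "AE x in M. \<bar>f x - ?g x\<bar> \<le> ?h x"
      using nonneg AE_space
    proof eventually_elim
      case (elim x)
      show ?case
        by (rule truncated_ln_error[OF _ _ _ k finite_index]) (use elim space B in auto)
    qed
  qed (use fi gi hi in auto)
  moreover have "(\<integral>x. ?h x \<partial>M) = 4 * B * (\<integral>x. (\<Sum>i\<in>I. (1 - exp_neg I x i) ^ k) \<partial>M)"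
    by simp
  ultimately show ?thesis by linarith
qed

end

lemma integral_exp_neg_tendsto:
  fixes \<mu> :: "nat \<Rightarrow> (nat \<Rightarrow> real) measure" and g :: "(nat \<Rightarrow> real) \<Rightarrow> real"
  assumes \<mu>: "\<And>n. nonneg_law (\<mu> n) I" and \<nu>: "nonneg_law \<nu> I"
    and laplace: "\<And>k :: nat \<Rightarrow> nat. (\<lambda>n. \<integral>x. (\<Prod>i\<in>I. exp (- (real (k i) * x i))) \<partial>\<mu> n)
      \<longlonglongrightarrow> (\<integral>x. (\<Prod>i\<in>I. exp (- (real (k i) * x i))) \<partial>\<nu>)"
    and g: "continuous_on UNIV g"
  shows "(\<lambda>n. \<integral>x. g (exp_neg I x) \<partial>\<mu> n) \<longlonglongrightarrow> (\<integral>x. g (exp_neg I x) \<partial>\<nu>)"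
proof -
  interpret \<nu>: nonneg_law \<nu> I by (rule \<nu>)
  have poly: "(\<lambda>n. \<integral>x. p (exp_neg I x) \<partial>\<mu> n) \<longlonglongrightarrow> (\<integral>x. p (exp_neg I x) \<partial>\<nu>)"
    if "p \<in> monomial_span I" for p
    using that
  proof induction
    case (monomial c k)
    have "(\<Prod>i\<in>I. exp_neg I x i ^ k i) = (\<Prod>i\<in>I. exp (- (real (k i) * x i)))" for x
      by (intro prod.cong) (auto simp: exp_neg_def simp flip: exp_of_nat_mult)
    then show ?case using tendsto_mult_left[OF laplace[of k], of c] by simp
  next
    case (add p q)
    note c = add.hyps[THEN continuous_on_monomial_span]
    have "(\<integral>x. p (exp_neg I x) + q (exp_neg I x) \<partial>M) = (\<integral>x. p (exp_neg I x) \<partial>M) + (\<integral>x. q (exp_neg I x) \<partial>M)"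
      if "nonneg_law M I" for M
      by (intro Bochner_Integration.integral_add nonneg_law.integrable_exp_neg[OF that] c)
    then show ?case using tendsto_add[OF add.IH] \<mu> \<nu> by simp
  qed
  show ?thesis
  proof (rule LIMSEQ_I)
    fix r :: real assume r: "0 < r"
    obtain p where p: "p \<in> monomial_span I" "\<And>y. y \<in> unit_cube I \<Longrightarrow> \<bar>g y - p y\<bar> < r / 3"
      using monomial_span_dense[OF \<nu>.finite_index continuous_on_subset[OF g], of "r/3"] r by auto
    from LIMSEQ_D[OF poly[OF p(1)], of "r/3"] r
    obtain n0 where n0: "\<And>n. n \<ge> n0 \<Longrightarrow> norm ((\<integral>x. p (exp_neg I x) \<partial>\<mu> n) - (\<integral>x. p (exp_neg I x) \<partial>\<nu>)) < r/3"
      by auto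
    show "\<exists>no. \<forall>n\<ge>no. norm ((\<integral>x. g (exp_neg I x) \<partial>\<mu> n) - (\<integral>x. g (exp_neg I x) \<partial>\<nu>)) < r"
    proof (intro exI[of _ n0] allI impI)
      fix n assume "n \<ge> n0"
      have "\<bar>(\<integral>x. g (exp_neg I x) \<partial>\<mu> n) - (\<integral>x. p (exp_neg I x) \<partial>\<mu> n)\<bar> \<le> r / 3"
        by (rule nonneg_law.integral_exp_neg_close[OF \<mu> g p(1)]) (rule p(2))
      moreover have "\<bar>(\<integral>x. g (exp_neg I x) \<partial>\<nu>) - (\<integral>x. p (exp_neg I x) \<partial>\<nu>)\<bar> \<le> r / 3"
        by (rule \<nu>.integral_exp_neg_close[OF g p(1)]) (rule p(2))
      ultimately show "norm ((\<integral>x. g (exp_neg I x) \<partial>\<mu> n) - (\<integral>x. g (exp_neg I x) \<partial>\<nu>)) < r"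
        using n0[OF \<open>n \<ge> n0\<close>] unfolding real_norm_def by linarith
    qed
  qed
qed

text \<open>Tightness of the sequence comes for free: \<open>k\<close> is chosen from
  \<open>\<nu>\<close> alone, and since the tail function is a polynomial in \<open>exp_neg\<close>,
  the same bound passes to \<open>\<mu> n\<close> for large \<open>n\<close>.\<close>

lemma laplace_imp_converges_in_distribution:
  fixes \<mu> :: "nat \<Rightarrow> (nat \<Rightarrow> real) measure"
  assumes \<mu>: "\<And>n. nonneg_law (\<mu> n) I" and \<nu>: "nonneg_law \<nu> I"
    and laplace: "\<And>k :: nat \<Rightarrow> nat. (\<lambda>n. \<integral>x. (\<Prod>i\<in>I. exp (- (real (k i) * x i))) \<partial>\<mu> n)
      \<longlonglongrightarrow> (\<integral>x. (\<Prod>i\<in>I. exp (- (real (k i) * x i))) \<partial>\<nu>)"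
  shows "converges_in_distribution (product_topology (\<lambda>_. euclideanreal) I) \<mu> \<nu>"
  unfolding converges_in_distribution_def
proof (intro allI impI, elim conjE)
  fix f :: "(nat \<Rightarrow> real) \<Rightarrow> real"
  assume f: "continuous_map (product_topology (\<lambda>_. euclideanreal) I) euclideanreal f"
    and bdd: "bounded (f ` topspace (product_topology (\<lambda>_. euclideanreal) I))"
  have "topspace (product_topology (\<lambda>_. euclideanreal) I) = extensional I"
    by (simp add: PiE_def)
  with bdd obtain B where "\<forall>y\<in>f ` extensional I. norm y \<le> B"
    by (auto simp only: bounded_iff)
  then have B: "\<bar>f y\<bar> \<le> B" if "y \<in> extensional I" for y
    using that by simp
  interpret \<nu>: nonneg_law \<nu> I by (rule \<nu>)
  note conv = integral_exp_neg_tendsto[OF \<mu> \<nu> laplace]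
  let ?h = "\<lambda>k M. \<integral>x. (\<Sum>i\<in>I. (1 - exp_neg I x i) ^ k) \<partial>M"
  let ?g = "\<lambda>k M. \<integral>x. f (\<lambda>i\<in>I. - ln (max (exp_neg I x i) (1 / (2 * real k)))) \<partial>M"
  show "(\<lambda>n. \<integral>x. f x \<partial>\<mu> n) \<longlonglongrightarrow> (\<integral>x. f x \<partial>\<nu>)"
  proof (rule tendstoI)
    fix r :: real assume r: "0 < r"
    have "(\<lambda>k. 4 * B * ?h k \<nu>) \<longlonglongrightarrow> 4 * B * 0"
      by (intro tendsto_mult_left \<nu>.tail_integral_tendsto_0)
    then have "eventually (\<lambda>k. 4 * B * ?h k \<nu> < r / 4) sequentially"
      using r by (intro order_tendstoD) auto
    from eventually_happens[OF eventually_conj[OF this eventually_gt_at_top[of 0]]]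
    obtain k where k: "4 * B * ?h k \<nu> < r / 4" "0 < k" by auto
    have "(\<lambda>n. 4 * B * ?h k (\<mu> n)) \<longlonglongrightarrow> 4 * B * ?h k \<nu>"
      by (intro tendsto_mult_left conv[of "\<lambda>y. \<Sum>i\<in>I. (1 - y i) ^ k"])
         (intro continuous_intros continuous_on_product_coordinates)
    then have "eventually (\<lambda>n. 4 * B * ?h k (\<mu> n) < r / 4) sequentially"
      using k by (intro order_tendstoD) auto
    moreover have "(\<lambda>n. ?g k (\<mu> n)) \<longlonglongrightarrow> ?g k \<nu>"
      by (rule conv[OF continuous_truncated_ln[OF f]]) (use k in simp)
    then have "eventually (\<lambda>n. dist (?g k (\<mu> n)) (?g k \<nu>) < r / 4) sequentially"
      using r by (intro tendstoD) auto
    ultimately show "eventually (\<lambda>n. dist (\<integral>x. f x \<partial>\<mu> n) (\<integral>x. f x \<partial>\<nu>) < r) sequentially"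
    proof eventually_elim
      case (elim n)
      have "\<bar>(\<integral>x. f x \<partial>\<mu> n) - ?g k (\<mu> n)\<bar> \<le> 4 * B * ?h k (\<mu> n)"
        by (rule nonneg_law.truncated_ln_integral_error[OF \<mu> f _ k(2)]) (rule B)
      moreover have "\<bar>(\<integral>x. f x \<partial>\<nu>) - ?g k \<nu>\<bar> \<le> 4 * B * ?h k \<nu>"
        by (rule \<nu>.truncated_ln_integral_error[OF f _ k(2)]) (rule B)
      ultimately show ?case
        using k(1) elim unfolding dist_real_def by linarith
    qed
  qed
qed

section \<open>The limit law\<close>

text \<open>Exponential tilting: \<open>exp (- (k * x))\<close> turns the density of rate 1 into
  \<open>1 / (1 + k)\<close> times the density of rate \<open>1 + k\<close>, whose total mass is
  1.\<close>

lemma exponential_laplace: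
  assumes "0 \<le> k"
  shows "integrable (density lborel (exponential_density 1)) (\<lambda>x. exp (- (k * x)))"
    and "(\<integral>x. exp (- (k * x)) \<partial>density lborel (exponential_density 1)) = 1 / (1 + k)"
proof -
  have k: "0 < 1 + k" using assms by simp
  interpret prob_space "density lborel (exponential_density (1 + k))"
    by (rule prob_space_exponential_density[OF k])
  have "(\<integral>\<^sup>+x. ennreal (exponential_density (1 + k) x) \<partial>lborel) = ennreal 1"
    using emeasure_space_1 by (simp add: emeasure_density)
  then have bi: "has_bochner_integral lborel (exponential_density (1 + k)) 1"
    by (intro has_bochner_integral_nn_integral) (auto simp: exponential_density_nonneg k)
  have eq: "exponential_density 1 x * exp (- (k * x)) = 1 / (1 + k) * exponential_density (1 + k) x" for x
  proof -
    have "exp (- x) * exp (- (k * x)) = exp (- (x * (1 + k)))"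
      by (simp add: algebra_simps flip: exp_add)
    then show ?thesis using k by (simp add: exponential_density_def)
  qed
  have "has_bochner_integral lborel (\<lambda>x. exponential_density 1 x * exp (- (k * x))) (1 / (1 + k))"
    using has_bochner_integral_mult_right[of "1 / (1 + k)", OF bi] unfolding eq by simp
  then have "has_bochner_integral (density lborel (exponential_density 1)) (\<lambda>x. exp (- (k * x))) (1 / (1 + k))"
    by (intro has_bochner_integral_density) (auto simp: exponential_density_nonneg)
  then show "integrable (density lborel (exponential_density 1)) (\<lambda>x. exp (- (k * x)))"
    "(\<integral>x. exp (- (k * x)) \<partial>density lborel (exponential_density 1)) = 1 / (1 + k)"
    by (auto simp: has_bochner_integral_iff)
qed

lemma exponential_PiM_laplace:
  fixes k :: "nat \<Rightarrow> real"
  assumes "finite I" "\<And>i. 0 \<le> k i"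
  shows "(\<integral>x. (\<Prod>i\<in>I. exp (- (k i * x i))) \<partial>PiM I (\<lambda>_. density lborel (exponential_density 1)))
    = (\<Prod>i\<in>I. 1 / (1 + k i))"
proof -
  interpret product_prob_space "\<lambda>_ :: nat. density lborel (exponential_density 1)" I
    by (simp add: product_prob_spaceI prob_space_exponential_density)
  show ?thesis
    using product_integral_prod[OF assms(1), of "\<lambda>i x. exp (- (k i * x))"] exponential_laplace[OF assms(2)]
    by simp
qed

lemma nonneg_law_exponential:
  assumes "finite I"
  shows "nonneg_law (PiM I (\<lambda>_. density lborel (exponential_density 1))) I"
proof -
  interpret product_prob_space "\<lambda>_ :: nat. density lborel (exponential_density 1)" I
    by (simp add: product_prob_spaceI prob_space_exponential_density)
  have "AE x in density lborel (exponential_density 1). 0 \<le> x"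
    by (subst AE_density) (auto simp: exponential_density_def)
  then have "AE x in PiM I (\<lambda>_. density lborel (exponential_density 1)). 0 \<le> x i" if "i \<in> I" for i
    using that by (intro AE_PiM_component) (auto intro: prob_space_exponential_density)
  then have "AE x in PiM I (\<lambda>_. density lborel (exponential_density 1)). \<forall>i\<in>I. 0 \<le> x i"
    using assms by (intro AE_finite_allI)
  then show ?thesis
    by unfold_locales (use assms in \<open>auto intro!: sets_PiM_cong\<close>)
qed

theorem theorem5:
  fixes m :: nat
  shows "converges_in_distribution
    (product_topology (\<lambda>_. euclideanreal) {..m})
    (\<lambda>N. distr (measure_pmf (growing_graph N)) (PiM {..m} (\<lambda>_. borel))
      (\<lambda>h. \<lambda>i\<in>{..m}. \<Delta>X N (N - m + 1 + i) h / (real N * ln (real N))))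
    (PiM {..m} (\<lambda>_. density lborel (exponential_density 1)))"
proof (rule laplace_imp_converges_in_distribution)
  show "nonneg_law (PiM {..m} (\<lambda>_. density lborel (exponential_density 1))) {..m}"
    by (rule nonneg_law_exponential) simp
next
  fix N
  let ?Y = "\<lambda>h. \<lambda>i\<in>{..m}. \<Delta>X N (N - m + 1 + i) h / (real N * ln (real N))"
  have Y: "?Y \<in> measure_pmf (growing_graph N) \<rightarrow>\<^sub>M PiM {..m} (\<lambda>_. borel)"
    by (auto simp: space_PiM)
  interpret prob_space "distr (measure_pmf (growing_graph N)) (PiM {..m} (\<lambda>_. borel)) ?Y"
    by (rule measure_pmf.prob_space_distr[OF Y])
  \<comment> \<open>\<open>nonneg_law\<close> is required for every \<open>N\<close>. For
    \<open>N = 0\<close> and \<open>N = 1\<close> the scale is 0 and the quotients are 0 by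
    convention.\<close>
  have "0 \<le> real N * ln (real N)" by (cases "N = 0") auto
  then have "AE h in measure_pmf (growing_graph N). \<forall>i\<in>{..m}. 0 \<le> ?Y h i"
    by (auto simp: AE_measure_pmf_iff intro!: divide_nonneg_nonneg \<Delta>X_nonneg)
  then have "AE x in distr (measure_pmf (growing_graph N)) (PiM {..m} (\<lambda>_. borel)) ?Y. \<forall>i\<in>{..m}. 0 \<le> x i"
    by (subst AE_distr_iff[OF Y]) auto
  then show "nonneg_law (distr (measure_pmf (growing_graph N)) (PiM {..m} (\<lambda>_. borel)) ?Y) {..m}"
    by unfold_locales auto
next
  fix k :: "nat \<Rightarrow> nat"
  let ?L = "\<lambda>N. real N * ln (real N)"
  let ?Y = "\<lambda>N h. \<lambda>i\<in>{..m}. \<Delta>X N (N - m + 1 + i) h / ?L N"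
  define \<kappa> where "\<kappa> w = (if w \<le> m then real (k (m - w)) else 0)" for w
  have eq: "(\<integral>x. (\<Prod>i\<le>m. exp (- (real (k i) * x i))) \<partial>distr (measure_pmf (growing_graph N)) (PiM {..m} (\<lambda>_. borel)) (?Y N))
    = pool_fun (\<lambda>w. exp (- \<kappa> w / ?L N)) (\<lambda>w. N - w) N 0" if "m \<le> N" for N
  proof -
    have "(\<integral>x. (\<Prod>i\<le>m. exp (- (real (k i) * x i))) \<partial>distr (measure_pmf (growing_graph N)) (PiM {..m} (\<lambda>_. borel)) (?Y N))
      = (\<integral>h. (\<Prod>i\<le>m. exp (- (real (k i) * ?Y N h i))) \<partial>measure_pmf (growing_graph N))"
      by (rule integral_distr) (auto simp: space_PiM)
    also have "\<dots> = (\<integral>h. history_weight (\<lambda>w. exp (- \<kappa> w / ?L N)) N h \<partial>measure_pmf (growing_graph N))"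
    proof (rule integral_cong_AE)
      show "AE h in measure_pmf (growing_graph N). (\<Prod>i\<le>m. exp (- (real (k i) * ?Y N h i)))
        = history_weight (\<lambda>w. exp (- \<kappa> w / ?L N)) N h"
        unfolding \<kappa>_def using prod_exp_\<Delta>X[OF _ that, of _ "\<lambda>i. real (k i)" "?L N"]
        by (simp add: AE_measure_pmf_iff)
    qed auto
    finally show ?thesis by (simp add: expectation_history_weight)
  qed
  have "(\<Prod>j\<le>m. 1 / (1 + \<kappa> j)) = (\<Prod>i\<le>m. 1 / (1 + real (k i)))"
    by (rule prod.reindex_bij_witness[of _ "\<lambda>i. m - i" "\<lambda>i. m - i"]) (auto simp: \<kappa>_def)
  also have "\<dots> = (\<integral>x. (\<Prod>i\<le>m. exp (- (real (k i) * x i))) \<partial>PiM {..m} (\<lambda>_. density lborel (exponential_density 1)))"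
    by (rule exponential_PiM_laplace[symmetric]) auto
  finally have limit: "(\<lambda>N. pool_fun (\<lambda>w. exp (- \<kappa> w / ?L N)) (\<lambda>w. N - w) N 0)
    \<longlonglongrightarrow> (\<integral>x. (\<Prod>i\<le>m. exp (- (real (k i) * x i))) \<partial>PiM {..m} (\<lambda>_. density lborel (exponential_density 1)))"
    using pool_fun_initial_limit[of \<kappa> m] by (simp add: \<kappa>_def)
  show "(\<lambda>N. \<integral>x. (\<Prod>i\<le>m. exp (- (real (k i) * x i))) \<partial>distr (measure_pmf (growing_graph N)) (PiM {..m} (\<lambda>_. borel)) (?Y N))
    \<longlonglongrightarrow> (\<integral>x. (\<Prod>i\<le>m. exp (- (real (k i) * x i))) \<partial>PiM {..m} (\<lambda>_. density lborel (exponential_density 1)))"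
    by (rule Lim_transform_eventually[OF limit])
       (rule eventually_mono[OF eventually_ge_at_top[of m]], rule eq[symmetric])
qed

end
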